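(* Let $n\ge 0$ be an integer. Each of the following three quantities equals $\frac{9n^2-5n+2}{2}$: (i) the maximum number of regions into which the plane can be divided by drawing $n$ long-legged 3-armed V's; (ii) the maximum number of regions into which the plane can be divided by drawing $n$ 3-chains; (iii) the maximum number of regions into which the plane can be divided by drawing $n$ long-legged A's.
   Context: For a family $\mathcal F$ of subsets of $\mathbb R^2$ ("shapes"), the number of regions determined by $S_1,\dots,S_n\in\mathcal F$ is the number of connected components of $\mathbb R^2\setminus (S_1\cup\dots\cup S_n)$, and the maximum number of regions for $n$ copies is the maximum of this over all choices of $S_1,\dots,S_n\in\mathcal F$ (for $n=0$ it is $1$). A long-legged 3-armed V is the union of three rays (closed half-lines) emanating from a common point (the tip), with arbitrary angles between them. A 3-chain is a continuous polygonal curve consisting of a ray, then a finite line segment, then a ray (the two rays being attached to the two endpoints of the segment). A long-legged A is the union of two rays emanating from a common point (the tip), with arbitrary angle between them, together with a line segment (crossbar) joining a point of one ray to a point of the other ray (the two endpoints need not be at equal distance from the tip). *)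

theory Defs
  imports "HOL-Analysis.Analysis"
begin

definition ray :: "real^2 \<Rightarrow> real^2 \<Rightarrow> (real^2) set" where
  "ray p v = {p + t *\<^sub>R v | t. 0 \<le> t}"

definition three_armed_Vs :: "(real^2) set set" where
  "three_armed_Vs =
     {ray p u \<union> ray p v \<union> ray p w | p u v w. u \<noteq> 0 \<and> v \<noteq> 0 \<and> w \<noteq> 0}"

text \<open>The two rays of a chain may cross each other: a 3-chain need not be a simple curve.\<close>

definition three_chains :: "(real^2) set set" where
  "three_chains =
     {ray p u \<union> closed_segment p q \<union> ray q v | p q u v. u \<noteq> 0 \<and> v \<noteq> 0 \<and> p \<noteq> q}"

definition long_legged_As :: "(real^2) set set" where
  "long_legged_As =
     {ray p u \<union> ray p v \<union> closed_segment a b | p u v a b.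
        u \<noteq> 0 \<and> v \<noteq> 0 \<and> a \<in> ray p u \<and> b \<in> ray p v \<and> a \<noteq> b}"

definition regions :: "nat \<Rightarrow> (nat \<Rightarrow> (real^2) set) \<Rightarrow> (real^2) set set" where
  "regions n S = components (UNIV - (\<Union>i<n. S i))"

text \<open>
  The value \<open>m\<close> is the maximum, over all choices of \<open>n\<close> shapes from the family \<open>F\<close>, of the number
  of regions.  Finiteness is stated explicitly because \<^const>\<open>card\<close> is 0 on infinite sets.
\<close>

definition is_max_regions :: "(real^2) set set \<Rightarrow> nat \<Rightarrow> real \<Rightarrow> bool" where
  "is_max_regions F n m \<longleftrightarrow>
     (\<exists>S. (\<forall>i<n. S i \<in> F) \<and> finite (regions n S) \<and> real (card (regions n S)) = m) \<and>
     (\<forall>S. (\<forall>i<n. S i \<in> F) \<longrightarrow> finite (regions n S) \<and> real (card (regions n S)) \<le> m)"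

end

theory Submission
  imports Defs
begin

text \<open>
  Adding to a closed set a closed subset \<open>S\<close> of a line creates at most one new region per gap,
  that is, per component of the part of \<open>S\<close> not drawn before, since only the two sides of the gap can
  become separated; a gap with a free end creates none.

  Upper bound: \<open>m\<close> shapes consist of \<open>3 m\<close> convex pieces.  A new piece meets each old one in a
  convex set, so it has boundedly many gaps; adding the pieces of a shape in an order that keeps them
  attached to each other gives at most \<open>9 m + 2\<close> new regions.

  Lower bound: take \<open>3 n\<close> full lines such that all crossings lie on the parts belonging to the
  shapes.  Each line, when added, splits in two exactly the convex regions that it meets, so the
  regions of the arrangement can be counted from its crossings.  Erasing the superfluous ends of the
  lines is the reverse of adding one gap per end, hence loses at most one region per end, and this
  leaves exactly the claimed number.
\<close>

section \<open>Removing a gap from an open set\<close>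

definition upper_collar :: "'a::euclidean_space \<Rightarrow> real \<Rightarrow> 'a set \<Rightarrow> 'a set \<Rightarrow> bool" where
  "upper_collar n c g K \<longleftrightarrow> (\<forall>x\<in>g. \<exists>r>0. ball x r \<inter> {y. c < n \<bullet> y} \<subseteq> K)"

lemma shift_in_half_ball:
  fixes n :: "'a::euclidean_space"
  assumes "n \<bullet> x = c" "n \<noteq> 0" "0 < r"
  shows "x + (r / (2 * norm n)) *\<^sub>R n \<in> ball x r \<inter> {y. c < n \<bullet> y}"
proof -
  have "0 < r / (2 * norm n) * (n \<bullet> n)" using assms(2,3) by simp
  moreover have "dist x (x + (r / (2 * norm n)) *\<^sub>R n) < r"
    using assms(2,3) by (simp add: dist_norm)
  ultimately show ?thesis using assms(1) by (simp add: inner_add_right)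
qed

lemma connected_upper_collar:
  fixes U g :: "'a::euclidean_space set"
  assumes "open U" "g \<subseteq> U" "connected g" "g \<subseteq> {x. n \<bullet> x = c}" "n \<noteq> 0"
  obtains K where "connected K" "K \<subseteq> U - g" "upper_collar n c g K"
proof -
  define r where "r x = (if U = UNIV then 1 else infdist x (- U))" for x
  define h where "h x = x + (r x / (2 * norm n)) *\<^sub>R n" for x
  define N where "N x = ball x (r x) \<inter> {y. c < n \<bullet> y}" for x
  have r_pos: "0 < r x" if "x \<in> g" for x
    using that assms(1,2) in_closed_iff_infdist_zero[of "- U" x] infdist_nonneg[of x "- U"]
    by (auto simp: r_def order_less_le)
  have ball_subset: "ball x (r x) \<subseteq> U" for x
  proof
    fix y assume "y \<in> ball x (r x)"
    then show "y \<in> U"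
      using infdist_le[of y "- U" x] by (cases "y \<in> U") (auto simp: r_def split: if_splits)
  qed
  have h_in: "h x \<in> N x" if "x \<in> g" for x
    unfolding h_def N_def using that assms(4,5) r_pos by (intro shift_in_half_ball) auto
  \<comment> \<open>The connected set \<open>h ` g\<close>, a copy of the gap pushed to one side, meets every half-ball \<open>N x\<close>.\<close>
  have "continuous_on g h"
    unfolding h_def r_def using \<open>n \<noteq> 0\<close> by (cases "U = UNIV") (auto intro!: continuous_intros)
  then have "connected (h ` g)"
    using \<open>connected g\<close> by (rule connected_continuous_image)
  moreover have "connected (N x)" for x
    unfolding N_def by (intro convex_connected convex_Int convex_ball convex_halfspace_gt)
  ultimately have "connected (h ` g \<union> N x)" if "x \<in> g" for x
    using h_in that by (intro connected_Un) auto
  then have "connected (\<Union>x\<in>g. h ` g \<union> N x)"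
    by (intro connected_Union) auto
  moreover have "(\<Union>x\<in>g. h ` g \<union> N x) = (\<Union>x\<in>g. N x)"
    using h_in by blast
  moreover have "(\<Union>x\<in>g. N x) \<subseteq> U - g"
    using ball_subset assms(4) by (force simp: N_def)
  moreover have "upper_collar n c g (\<Union>x\<in>g. N x)"
    unfolding upper_collar_def N_def using r_pos by blast
  ultimately show thesis
    by (metis that)
qed

lemma component_Diff_closure_meets:
  fixes U g :: "'a::real_normed_vector set"
  assumes "open U" "open (U - g)" "C \<in> components (U - g)" "C \<notin> components U"
  shows "closure C \<inter> g \<noteq> {}"
proof
  assume disj: "closure C \<inter> g = {}"
  obtain D where D: "D \<in> components U" "C \<subseteq> D"
  proof -
    have "C \<subseteq> U" "C \<noteq> {}" "connected C"
      using assms(3) in_components_subset in_components_nonempty in_components_connected by blast+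
    then show thesis
      using exists_component_superset[of C U] that by blast
  qed
  have "open C" using assms(2,3) open_components by blast
  then have "openin (top_of_set D) C"
    using D(2) open_subset by blast
  moreover have "closedin (top_of_set D) C"
  proof -
    have "closure C \<inter> (U - g) \<subseteq> C"
      using closedin_component[OF assms(3)] closure_minimal[of C] unfolding closedin_closed by blast
    then have "C = D \<inter> closure C"
      using D disj in_components_subset closure_subset by blast
    then show ?thesis by (metis closed_closure closedin_closed_Int)
  qed
  ultimately have "C = D"
    using in_components_connected[OF D(1)] in_components_nonempty[OF assms(3)]
    unfolding connected_clopen by blast
  then show False using D(1) assms(4) by blast
qed

lemma open_meets_halfspace:
  fixes n :: "'a::euclidean_space"
  assumes "open W" "z \<in> W" "n \<bullet> z = c" "n \<noteq> 0"
  shows "W \<inter> {x. c < n \<bullet> x} \<noteq> {}"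
proof -
  have "z \<in> closure {x. c < n \<bullet> x}" using assms(3,4) by simp
  then show ?thesis using assms(2) open_Int_closure_eq_empty[OF assms(1)] by blast
qed

lemma open_meets_halfspaces:
  fixes n :: "'a::euclidean_space"
  assumes "open W" "z \<in> W" "n \<bullet> z = c" "n \<noteq> 0"
  shows "W \<inter> {x. c < n \<bullet> x} \<noteq> {}" "W \<inter> {x. n \<bullet> x < c} \<noteq> {}"
  using open_meets_halfspace[OF assms] open_meets_halfspace[of W z "- n" "- c"] assms by auto

text \<open>\<open>P\<close> and \<open>Q\<close> are the two sides of the gap; they coincide if one can pass around an end of it.\<close>

lemma components_adjacent_to_gap:
  fixes U g :: "'a::euclidean_space set" and n :: 'a and c :: real
  assumes U: "open U" "g \<subseteq> U" "open (U - g)"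
    and g: "connected g" "g \<noteq> {}" "g \<subseteq> {x. n \<bullet> x = c}" and "n \<noteq> 0"
  obtains P Q where "P \<in> components (U - g)" "Q \<in> components (U - g)"
    "upper_collar n c g P" "upper_collar (- n) (- c) g Q"
proof -
  obtain K where K: "connected K" "K \<subseteq> U - g" "upper_collar n c g K"
    using connected_upper_collar[OF U(1,2) g(1) g(3) \<open>n \<noteq> 0\<close>] by blast
  have "g \<subseteq> {x. - n \<bullet> x = - c}" "- n \<noteq> 0" using g(3) \<open>n \<noteq> 0\<close> by auto
  then obtain L where L: "connected L" "L \<subseteq> U - g" "upper_collar (- n) (- c) g L"
    using connected_upper_collar[OF U(1,2) g(1)] by blast
  have "interior {x. n \<bullet> x = c} = {}" using \<open>n \<noteq> 0\<close> by simp
  then have "U - g \<noteq> {}"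
    using U(1,2) g(2,3) interior_maximal[of U "{x. n \<bullet> x = c}"] by blast
  then obtain P Q where "P \<in> components (U - g)" "K \<subseteq> P" "Q \<in> components (U - g)" "L \<subseteq> Q"
    using exists_component_superset[OF K(2) _ K(1)] exists_component_superset[OF L(2) _ L(1)] by blast
  moreover from this have "upper_collar n c g P" "upper_collar (- n) (- c) g Q"
    using K(3) L(3) unfolding upper_collar_def by (meson order_trans)+
  ultimately show thesis using that by blast
qed

lemma component_Diff_gap_cases:
  fixes U g :: "'a::euclidean_space set" and n :: 'a and c :: real
  assumes U: "open U" "open (U - g)" and "n \<noteq> 0"
    and P: "P \<in> components (U - g)" "upper_collar n c g P"
    and Q: "Q \<in> components (U - g)" "upper_collar (- n) (- c) g Q"
    and C: "C \<in> components (U - g)" "C \<notin> components U"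
  shows "C = P \<or> C = Q"
proof -
  obtain x where x: "x \<in> closure C" "x \<in> g"
    using component_Diff_closure_meets[OF U C] by blast
  obtain r s where r: "0 < r" "ball x r \<inter> {y. c < n \<bullet> y} \<subseteq> P"
      and s: "0 < s" "ball x s \<inter> {y. - c < - n \<bullet> y} \<subseteq> Q"
    using P(2) Q(2) x(2) unfolding upper_collar_def by blast
  let ?B = "ball x (min r s)"
  have "open (C \<inter> ?B)" using open_components[OF U(2) C(1)] by blast
  moreover have "x \<in> ?B" using r(1) s(1) by simp
  then have "C \<inter> ?B \<noteq> {}"
    using x(1) open_Int_closure_eq_empty[OF open_ball, of x "min r s" C] by blast
  moreover have "interior {y. n \<bullet> y = c} = {}" using \<open>n \<noteq> 0\<close> by simp
  ultimately obtain y where y: "y \<in> C \<inter> ?B" "n \<bullet> y \<noteq> c"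
    using interior_maximal[of "C \<inter> ?B" "{y. n \<bullet> y = c}"] by blast
  then have "y \<in> P \<or> y \<in> Q" using r(2) s(2) by (cases "c < n \<bullet> y") auto
  then show ?thesis using y C(1) P(1) Q(1) components_eq by blast
qed

lemma gap_sides_eq:
  fixes U g :: "'a::euclidean_space set" and n :: 'a and c :: real
  assumes U: "open U" "g \<subseteq> U" "open (U - g)" and "n \<noteq> 0"
    and P: "P \<in> components (U - g)" "upper_collar n c g P"
    and Q: "Q \<in> components (U - g)" "upper_collar (- n) (- c) g Q"
    and e: "e \<in> g" "e \<in> closure ({x. n \<bullet> x = c} - g)"
  shows "P = Q"
proof -
  obtain r s t where r: "0 < r" "ball e r \<inter> {y. c < n \<bullet> y} \<subseteq> P"
      and s: "0 < s" "ball e s \<inter> {y. - c < - n \<bullet> y} \<subseteq> Q" and t: "0 < t" "ball e t \<subseteq> U"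
    using P(2) Q(2) e(1) U(1,2) unfolding upper_collar_def by (meson openE subsetD)
  let ?B = "ball e (min r (min s t))"
  have "e \<in> ?B" using r(1) s(1) t(1) by simp
  then have "?B \<inter> ({x. n \<bullet> x = c} - g) \<noteq> {}"
    using e(2) open_Int_closure_eq_empty[OF open_ball, of e "min r (min s t)" "{x. n \<bullet> x = c} - g"]
    by blast
  then obtain z where z: "z \<in> ?B" "n \<bullet> z = c" "z \<notin> g" by blast
  then have "z \<in> ?B \<inter> (U - g)" using t(2) by auto
  then obtain d where d: "0 < d" "ball z d \<subseteq> ?B \<inter> (U - g)"
    using U(3) by (meson openE open_Int open_ball)
  have "ball z d \<inter> {y. c < n \<bullet> y} \<noteq> {}" "ball z d \<inter> {y. n \<bullet> y < c} \<noteq> {}"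
    using open_meets_halfspaces[of "ball z d" z n c] d(1) z(2) \<open>n \<noteq> 0\<close> by simp_all
  then obtain y y' where y: "y \<in> ball z d" "c < n \<bullet> y" and y': "y' \<in> ball z d" "n \<bullet> y' < c"
    by blast
  moreover have "y \<in> ?B" "y' \<in> ?B" using y(1) y'(1) d(2) by blast+
  ultimately have "y \<in> P" "y' \<in> Q" using r(2) s(2) by auto
  then have meets: "P \<inter> ball z d \<noteq> {}" "Q \<inter> ball z d \<noteq> {}"
    using y(1) y'(1) by blast+
  have "ball z d \<subseteq> P"
    using components_maximal[OF P(1) connected_ball _ meets(1)] d(2) by blast
  then show ?thesis using meets(2) P(1) Q(1) components_eq by blast
qed

section \<open>Counting the regions created by a closed subset of a hyperplane\<close>

definition new_regions_le :: "nat \<Rightarrow> 'a::topological_space set \<Rightarrow> 'a set \<Rightarrow> bool" where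
  "new_regions_le k A B \<longleftrightarrow> (finite (components (- A)) \<longrightarrow>
     finite (components (- B)) \<and> card (components (- B)) \<le> card (components (- A)) + k)"

lemma new_regions_le_refl: "new_regions_le k A A"
  by (simp add: new_regions_le_def)

lemma new_regions_le_trans: "new_regions_le k A B \<Longrightarrow> new_regions_le l B C \<Longrightarrow> new_regions_le (k + l) A C"
  by (auto simp: new_regions_le_def)

lemma new_regions_le_mono: "new_regions_le k A B \<Longrightarrow> k \<le> l \<Longrightarrow> new_regions_le l A B"
  by (auto simp: new_regions_le_def)

lemma new_regions_le_gap:
  fixes A g :: "'a::euclidean_space set"
  assumes "closed A" "closed (A \<union> g)" "g \<inter> A = {}" "connected g" "g \<subseteq> {x. n \<bullet> x = c}" "n \<noteq> 0"
  shows "new_regions_le (of_bool (g \<inter> closure ({x. n \<bullet> x = c} - g) = {})) A (A \<union> g)"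
proof (cases "g = {}")
  case False
  have Compl_eq: "- (A \<union> g) = - A - g" by blast
  have "open (- A - g)" using assms(2) Compl_eq by (metis open_Compl)
  moreover have "open (- A)" "g \<subseteq> - A" using assms(1,3) by auto
  ultimately have U: "open (- A)" "g \<subseteq> - A" "open (- A - g)" by simp_all
  obtain P Q where P: "P \<in> components (- A - g)" "upper_collar n c g P"
      and Q: "Q \<in> components (- A - g)" "upper_collar (- n) (- c) g Q"
    using components_adjacent_to_gap[OF U assms(4) False assms(5,6)] .
  obtain D where D: "D \<in> components (- A)" "g \<subseteq> D"
    using exists_component_superset[OF U(2) _ assms(4)] U(2) False by blast
  have "C \<noteq> D" if "C \<in> components (- A - g)" for C
    using in_components_subset[OF that] D(2) False by blast
  then have subset: "components (- A - g) \<subseteq> {P, Q} \<union> (components (- A) - {D})"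
    using component_Diff_gap_cases[OF U(1,3) assms(6) P Q] by blast
  show ?thesis
    unfolding new_regions_le_def Compl_eq
  proof
    let ?k = "of_bool (g \<inter> closure ({x. n \<bullet> x = c} - g) = {})"
    assume fin: "finite (components (- A))"
    have "card (components (- A - g)) \<le> card {P, Q} + card (components (- A) - {D})"
      using subset fin by (intro order_trans[OF card_mono card_Un_le]) auto
    moreover have "card {P, Q} \<le> 1 + ?k"
      using gap_sides_eq[OF U assms(6) P Q] by (auto simp: card_insert_if)
    moreover have "Suc (card (components (- A) - {D})) = card (components (- A))"
      using fin D(1) by (rule card_Suc_Diff1)
    ultimately show "finite (components (- A - g)) \<and>
        card (components (- A - g)) \<le> card (components (- A)) + ?k"
      using fin finite_subset[OF subset] by simp
  qed
qed (simp add: new_regions_le_refl)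

lemma closed_Un_component_Diff:
  assumes "closed A" "closed S" "C \<in> components (S - A)"
  shows "closed (A \<union> C)"
proof -
  obtain T where "closed T" "C = (S - A) \<inter> T"
    using closedin_component[OF assms(3)] unfolding closedin_closed by blast
  then have "A \<union> C = A \<union> (S \<inter> T)" by blast
  then show ?thesis using assms(1,2) \<open>closed T\<close> by auto
qed

text \<open>A gap that reaches \<open>closure (H - S)\<close> has a free end.\<close>

theorem new_regions_le_hyperplane:
  fixes A S :: "'a::euclidean_space set" and n :: 'a and c :: real
  defines "H \<equiv> {x. n \<bullet> x = c}"
  assumes closed: "closed A" "closed S" and "S \<subseteq> H" "n \<noteq> 0" and fin: "finite (components (S - A))"
  shows "new_regions_le (card {C \<in> components (S - A). C \<inter> closure (H - S) = {}}) A (A \<union> S)"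
proof -
  let ?bounded = "\<lambda>C. C \<inter> closure (H - S) = {}"
  have partial: "closed (A \<union> \<Union>\<G>) \<and> new_regions_le (card {C \<in> \<G>. ?bounded C}) A (A \<union> \<Union>\<G>)"
    if "finite \<G>" "\<G> \<subseteq> components (S - A)" for \<G>
    using that
  proof (induction \<G> rule: finite_subset_induct')
    case empty
    then show ?case using closed by (simp add: new_regions_le_refl)
  next
    case (insert C \<G>)
    let ?B = "A \<union> \<Union>\<G>"
    have C: "C \<subseteq> S" "connected C" "C \<inter> A = {}"
      using insert.hyps(2) in_components_subset in_components_connected by blast+
    have B: "closed ?B" "closed (?B \<union> C)"
      using insert.IH closed_Un[OF _ closed_Un_component_Diff[OF closed insert.hyps(2)], of ?B]
      by (auto simp: Un_ac)
    have "C \<inter> \<Union>\<G> = {}"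
      using insert.hyps components_nonoverlap by fastforce
    then have "new_regions_le (of_bool (C \<inter> closure (H - C) = {})) ?B (?B \<union> C)"
      unfolding H_def using B C \<open>S \<subseteq> H\<close> \<open>n \<noteq> 0\<close> by (intro new_regions_le_gap) (auto simp: H_def)
    moreover have "C \<inter> closure (H - C) = {} \<Longrightarrow> ?bounded C"
      using closure_mono[of "H - S" "H - C"] C(1) by blast
    ultimately have "new_regions_le (of_bool (?bounded C)) ?B (?B \<union> C)"
      by (elim new_regions_le_mono) auto
    then have "new_regions_le (card {C \<in> \<G>. ?bounded C} + of_bool (?bounded C)) A (?B \<union> C)"
      using insert.IH new_regions_le_trans by blast
    moreover have "{D \<in> insert C \<G>. ?bounded D} =
        (if ?bounded C then insert C else id) {D \<in> \<G>. ?bounded D}"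
      by auto
    ultimately show ?case
      using B insert.hyps(1,4) by (cases "?bounded C") (simp_all add: Un_ac)
  qed
  show ?thesis using partial[OF fin order_refl] by simp
qed

section \<open>Half-lines and segments\<close>

abbreviation along :: "'a::real_vector \<Rightarrow> 'a \<Rightarrow> real \<Rightarrow> 'a" where
  "along p v t \<equiv> p + t *\<^sub>R v"

lemma inj_along: "v \<noteq> 0 \<Longrightarrow> inj (along p v)"
  by (auto intro: injI)

lemma continuous_on_along: "continuous_on S (along p v)" for p v :: "'a::real_normed_vector"
  by (intro continuous_intros)

lemma along_image_eq: "along p v ` J = (+) p ` ((\<lambda>t. t *\<^sub>R v) ` J)"
  by (simp add: image_image)

lemma closed_along_image:
  fixes v :: "'a::euclidean_space"
  assumes "closed J" "v \<noteq> 0"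
  shows "closed (along p v ` J)"
  unfolding along_image_eq using assms
  by (intro closed_translation closed_injective_linear_image)
    (auto simp: linear_scaleR_left intro: injI)

lemma convex_along_image: "convex J \<Longrightarrow> convex (along p v ` J)"
  unfolding along_image_eq
  by (intro convex_translation convex_linear_image) (auto simp: linear_scaleR_left)

lemma closed_along_vimage: "closed C \<Longrightarrow> closed (along p v -` C)" for p v :: "'a::real_normed_vector"
  by (intro continuous_closed_vimage) (auto intro!: continuous_intros)

lemma open_along_vimage: "open C \<Longrightarrow> open (along p v -` C)" for p v :: "'a::real_normed_vector"
  by (intro open_vimage continuous_on_along)

lemma convex_along_vimage:
  assumes "convex C"
  shows "convex (along p v -` C)"
proof -
  have "along p v -` C = (\<lambda>t. t *\<^sub>R v) -` ((+) (- p) ` C)"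
    by (auto simp: image_iff) (metis add_minus_cancel uminus_add_conv_diff)
  then show ?thesis
    using assms by (simp add: convex_linear_vimage convex_translation linear_scaleR_left)
qed

lemma homeomorphism_along:
  fixes v :: "'a::euclidean_space"
  assumes "v \<noteq> 0"
  shows "homeomorphism J (along p v ` J) (along p v) (\<lambda>x. ((x - p) \<bullet> v) / (v \<bullet> v))"
proof (rule homeomorphismI)
  show "continuous_on (along p v ` J) (\<lambda>x. ((x - p) \<bullet> v) / (v \<bullet> v))"
    using assms by (intro continuous_intros) auto
qed (use assms continuous_on_along in auto)

lemma components_homeomorphism:
  assumes "homeomorphism S T f g"
  shows "components T = (`) f ` components S"
proof -
  have "T = f ` S" using assms by (simp add: homeomorphism_def)
  then show ?thesis
    using connected_component_set_homeomorphism[OF assms]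
    by (auto simp: components_def image_image)
qed

lemma convex_real_less:
  fixes T :: "real set"
  assumes "convex T" "s \<in> T" "t \<in> T" "y \<notin> T" "s < y"
  shows "t < y"
proof (rule ccontr)
  assume "\<not> t < y"
  then have "y \<in> {s..t}" using \<open>s < y\<close> by simp
  then show False
    using connected_contains_Icc[OF convex_connected[OF assms(1)] assms(2,3)] assms(4) by blast
qed

lemma gap_starts_at_convex_set:
  fixes J :: "real set" and T :: "'i \<Rightarrow> real set"
  assumes J: "connected J" "a \<in> J" "J \<subseteq> {a..}"
    and T: "finite K" "\<forall>k\<in>K. closed (T k)" "\<forall>k\<in>K. convex (T k)"
    and C: "C \<in> components (J - (\<Union>k\<in>K. T k))" "a \<notin> C"
  obtains k s y where "k \<in> K" "s \<in> T k" "y \<in> C" "s < y" "{s<..y} \<subseteq> C" "\<And>t. t \<in> T k \<Longrightarrow> t < y"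
proof -
  define X where "X = J - (\<Union>k\<in>K. T k)"
  note C = C[folded X_def]
  obtain y where y: "y \<in> C" using C(1) in_components_nonempty by blast
  then have "y \<in> X" using C(1) in_components_subset by blast
  then have "a \<le> y" "{a..y} \<subseteq> J"
    using J connected_contains_Icc[of J a y] by (auto simp: X_def)
  define D where "D = (\<Union>k\<in>K. T k) \<inter> {a..y}"
  have "compact D"
    unfolding D_def using T by (intro closed_Int_compact closed_UN) auto
  moreover have "D \<noteq> {}"
  proof
    assume "D = {}"
    then have "{a..y} \<subseteq> X" using \<open>{a..y} \<subseteq> J\<close> by (auto simp: D_def X_def)
    moreover have "y \<in> C \<inter> {a..y}" using y \<open>a \<le> y\<close> by simp
    ultimately have "{a..y} \<subseteq> C"
      using components_maximal[OF C(1) connected_Icc] by blast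
    then show False using C(2) \<open>a \<le> y\<close> by auto
  qed
  ultimately obtain s where s: "s \<in> D" "\<And>t. t \<in> D \<Longrightarrow> t \<le> s"
    using compact_attains_sup[of D] by auto
  have "s < y" using s(1) \<open>y \<in> X\<close> by (auto simp: D_def X_def order_less_le)
  have "{s<..y} \<subseteq> {a..y}" using s(1) by (auto simp: D_def)
  moreover have "{s<..y} \<inter> D = {}" using s(2) by force
  ultimately have "{s<..y} \<subseteq> X"
    using \<open>{a..y} \<subseteq> J\<close> unfolding X_def D_def by blast
  moreover have "y \<in> C \<inter> {s<..y}" using y \<open>s < y\<close> by simp
  ultimately have "{s<..y} \<subseteq> C"
    using components_maximal[OF C(1) connected_Ioc] by blast
  moreover obtain k where k: "k \<in> K" "s \<in> T k" using s(1) by (auto simp: D_def)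
  moreover have "t < y" if "t \<in> T k" for t
    using convex_real_less[OF bspec[OF T(3) k(1)] k(2) that _ \<open>s < y\<close>] \<open>y \<in> X\<close> k(1)
    by (auto simp: X_def)
  ultimately show thesis using that y \<open>s < y\<close> by blast
qed

text \<open>Gaps starting at the same convex set coincide.\<close>

lemma card_gaps_le:
  fixes J :: "real set" and T :: "'i \<Rightarrow> real set" and K :: "'i set"
  defines "X \<equiv> J - (\<Union>k\<in>K. T k)"
  assumes J: "connected J" "a \<in> J" "J \<subseteq> {a..}"
    and T: "finite K" "\<forall>k\<in>K. closed (T k)" "\<forall>k\<in>K. convex (T k)"
  shows "finite {C \<in> components X. a \<notin> C} \<and>
    card {C \<in> components X. a \<notin> C} \<le> card {k \<in> K. \<exists>t\<in>J. \<forall>s\<in>J \<inter> T k. s < t}"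
proof -
  let ?G = "{C \<in> components X. a \<notin> C}" and ?K = "{k \<in> K. \<exists>t\<in>J. \<forall>s\<in>J \<inter> T k. s < t}"
  define starts where "starts C k s y \<longleftrightarrow>
    k \<in> K \<and> s \<in> T k \<and> y \<in> C \<and> s < y \<and> {s<..y} \<subseteq> C \<and> (\<forall>t\<in>T k. t < y)" for C k s y
  have "\<exists>k s y. starts C k s y" if "C \<in> ?G" for C
  proof -
    have "C \<in> components (J - (\<Union>k\<in>K. T k))" "a \<notin> C"
      using that unfolding X_def by simp_all
    then show ?thesis
      unfolding starts_def by (rule gap_starts_at_convex_set[OF J T]) blast+
  qed
  then obtain k s y where "\<And>C. C \<in> ?G \<Longrightarrow> starts C (k C) (s C) (y C)"
    by metis
  then have k: "k C \<in> K" "s C \<in> T (k C)" and y: "y C \<in> C" "s C < y C" "{s C<..y C} \<subseteq> C"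
      and before_y: "\<forall>t\<in>T (k C). t < y C" if "C \<in> ?G" for C
    using that unfolding starts_def by blast+
  have same: "C = C'" if C: "C \<in> ?G" "C' \<in> ?G" "k C = k C'" "s C \<le> s C'" for C C'
  proof -
    have "s C' < y C" using before_y[OF C(1)] k(2)[OF C(2)] C(3) by simp
    then have "min (y C) (y C') \<in> {s C<..y C} \<inter> {s C'<..y C'}"
      using y(2)[OF C(2)] C(4) by auto
    then have "C \<inter> C' \<noteq> {}" using y(3)[OF C(1)] y(3)[OF C(2)] by blast
    then show ?thesis using C(1,2) components_eq by blast
  qed
  have "inj_on k ?G"
  proof (rule inj_onI)
    fix C C' assume "C \<in> ?G" "C' \<in> ?G" "k C = k C'"
    then show "C = C'"
      using same[of C C'] same[of C' C] linear[of "s C" "s C'"] by argo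
  qed
  moreover have "k C \<in> ?K" if "C \<in> ?G" for C
  proof -
    have "y C \<in> J" using y(1)[OF that] that in_components_subset[of C X] by (auto simp: X_def)
    then show ?thesis using k(1)[OF that] before_y[OF that] by blast
  qed
  then have "k ` ?G \<subseteq> ?K" by (rule image_subsetI)
  moreover have "finite ?K" using T(1) by simp
  ultimately show ?thesis
    by (simp add: card_inj_on_le inj_on_finite)
qed

lemma new_regions_le_along:
  fixes p v :: "'a::euclidean_space"
  defines "\<gamma> \<equiv> along p v"
  assumes "2 \<le> DIM('a)" "v \<noteq> 0" "closed A" "closed J" and fin: "finite (components (J - \<gamma> -` A))"
  shows "new_regions_le (card {C \<in> components (J - \<gamma> -` A). C \<inter> closure (- J) = {}}) A (A \<union> \<gamma> ` J)"
proof -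
  obtain n where n: "n \<noteq> 0" "v \<bullet> n = 0"
    using orthogonal_to_vector_exists[OF assms(2), of v] by (auto simp: orthogonal_def)
  define H where "H = {x. n \<bullet> x = n \<bullet> p}"
  have on_H: "\<gamma> t \<in> H" for t
    using n(2) by (simp add: \<gamma>_def H_def inner_add_right inner_commute)
  have "\<gamma> ` J - A = \<gamma> ` (J - \<gamma> -` A)" by blast
  then have comps: "components (\<gamma> ` J - A) = (`) \<gamma> ` components (J - \<gamma> -` A)"
    unfolding \<gamma>_def using components_homeomorphism[OF homeomorphism_along[OF \<open>v \<noteq> 0\<close>]] by metis
  have "\<gamma> ` (- J) \<subseteq> H - \<gamma> ` J"
    using on_H inj_along[OF \<open>v \<noteq> 0\<close>, of p] by (auto simp: \<gamma>_def inj_def)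
  then have "\<gamma> ` closure (- J) \<subseteq> closure (H - \<gamma> ` J)"
    unfolding \<gamma>_def
    by (intro image_closure_subset continuous_on_along closed_closure) (meson closure_subset order_trans)
  then have "{C \<in> components (\<gamma> ` J - A). C \<inter> closure (H - \<gamma> ` J) = {}}
      \<subseteq> (`) \<gamma> ` {C \<in> components (J - \<gamma> -` A). C \<inter> closure (- J) = {}}"
    unfolding comps by blast
  then have card_le: "card {C \<in> components (\<gamma> ` J - A). C \<inter> closure (H - \<gamma> ` J) = {}}
      \<le> card {C \<in> components (J - \<gamma> -` A). C \<inter> closure (- J) = {}}"
    using fin by (intro surj_card_le) auto
  have "new_regions_le (card {C \<in> components (\<gamma> ` J - A). C \<inter> closure (H - \<gamma> ` J) = {}})
      A (A \<union> \<gamma> ` J)"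
    unfolding H_def
  proof (rule new_regions_le_hyperplane)
    show "closed (\<gamma> ` J)" unfolding \<gamma>_def using assms by (intro closed_along_image)
    show "finite (components (\<gamma> ` J - A))" unfolding comps using fin by simp
  qed (use assms n(1) on_H in \<open>auto simp: H_def\<close>)
  then show ?thesis using card_le by (rule new_regions_le_mono)
qed

lemma new_regions_le_range_along:
  fixes p v :: "'a::euclidean_space"
  assumes "2 \<le> DIM('a)" "v \<noteq> 0" "closed A" "finite (components (- (along p v -` A)))"
  shows "new_regions_le (card (components (- (along p v -` A)))) A (A \<union> range (along p v))"
  using new_regions_le_along[OF assms(1-3) closed_UNIV, of p] assms(4)
  by (simp add: Compl_eq_Diff_UNIV)

lemma new_regions_le_along_half_line:
  fixes p v :: "'a::euclidean_space"
  defines "\<gamma> \<equiv> along p v"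
  assumes "2 \<le> DIM('a)" "v \<noteq> 0" "closed A"
    and J: "closed J" "connected J" "a \<in> J" "J \<subseteq> {a..}"
    and \<C>: "finite \<C>" "\<And>C. C \<in> \<C> \<Longrightarrow> closed C \<and> convex C" "J \<inter> \<gamma> -` A = J \<inter> \<gamma> -` \<Union>\<C>"
  shows "new_regions_le (card {C \<in> \<C>. \<exists>t\<in>J. \<forall>s\<in>J. \<gamma> s \<in> C \<longrightarrow> s < t}) A (A \<union> \<gamma> ` J)"
proof -
  define X where "X = J - \<gamma> -` A"
  have X_eq: "X = J - (\<Union>C\<in>\<C>. \<gamma> -` C)" using \<C>(3) by (auto simp: X_def)
  have gaps: "finite {C \<in> components X. a \<notin> C}"
    "card {C \<in> components X. a \<notin> C} \<le> card {C \<in> \<C>. \<exists>t\<in>J. \<forall>s\<in>J \<inter> \<gamma> -` C. s < t}"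
    using card_gaps_le[OF J(2-4) \<C>(1), of "\<lambda>C. \<gamma> -` C"] \<C>(2)
    unfolding X_eq \<gamma>_def by (simp_all add: closed_along_vimage convex_along_vimage)
  have "components X \<subseteq> insert (connected_component_set X a) {C \<in> components X. a \<notin> C}"
    using connected_component_eq by (fastforce simp: components_def)
  then have fin: "finite (components X)"
    using gaps(1) by (meson finite_insert finite_subset)
  have "{..a} \<subseteq> closure (- J)"
    using J(4) closure_mono[of "{..<a}" "- J"] by force
  then have "{C \<in> components X. C \<inter> closure (- J) = {}} \<subseteq> {C \<in> components X. a \<notin> C}"
    by auto
  then have "card {C \<in> components X. C \<inter> closure (- J) = {}} \<le> card {C \<in> components X. a \<notin> C}"
    using gaps(1) by (intro card_mono)
  also note gaps(2)
  also have "{C \<in> \<C>. \<exists>t\<in>J. \<forall>s\<in>J \<inter> \<gamma> -` C. s < t} = {C \<in> \<C>. \<exists>t\<in>J. \<forall>s\<in>J. \<gamma> s \<in> C \<longrightarrow> s < t}"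
    by auto
  finally show ?thesis
    using new_regions_le_along[OF assms(2-4) J(1), of p] fin
    unfolding X_def \<gamma>_def by (blast intro: new_regions_le_mono)
qed

definition convex_union :: "nat \<Rightarrow> 'a::real_normed_vector set \<Rightarrow> bool" where
  "convex_union k A \<longleftrightarrow>
     (\<exists>\<C>. finite \<C> \<and> card \<C> \<le> k \<and> (\<forall>C\<in>\<C>. closed C \<and> convex C) \<and> A = \<Union>\<C>)"

lemma closed_convex_union: "convex_union k A \<Longrightarrow> closed A"
  by (auto simp: convex_union_def intro!: closed_Union)

lemma convex_union_empty: "convex_union 0 {}"
  unfolding convex_union_def by (intro exI[of _ "{}"]) auto

lemma convex_union_singleton: "closed C \<Longrightarrow> convex C \<Longrightarrow> convex_union 1 C"
  unfolding convex_union_def by (intro exI[of _ "{C}"]) auto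

lemma convex_union_Un:
  assumes "convex_union k A" "convex_union l B"
  shows "convex_union (k + l) (A \<union> B)"
proof -
  obtain \<C> \<D> where "finite \<C>" "card \<C> \<le> k" "\<forall>C\<in>\<C>. closed C \<and> convex C" "A = \<Union>\<C>"
      "finite \<D>" "card \<D> \<le> l" "\<forall>C\<in>\<D>. closed C \<and> convex C" "B = \<Union>\<D>"
    using assms unfolding convex_union_def by blast
  moreover from this have "card (\<C> \<union> \<D>) \<le> k + l"
    using card_Un_le[of \<C> \<D>] by linarith
  ultimately show ?thesis
    unfolding convex_union_def by (intro exI[of _ "\<C> \<union> \<D>"]) auto
qed

lemma ray_eq_along: "ray p v = along p v ` {0..}"
  by (auto simp: ray_def)

lemma along_image_atLeast: "along p v ` {l..} = ray (along p v l) v"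
proof -
  have "{l..} = (+) l ` {0..}" by simp
  then show ?thesis by (simp only: ray_eq_along image_image) (simp add: algebra_simps)
qed

lemma along_image_atMost: "along p v ` {..u} = ray (along p v u) (- v)"
proof -
  have "{..u} = (-) u ` {0..}" by simp
  then show ?thesis by (simp only: ray_eq_along image_image) (simp add: algebra_simps)
qed

lemma along_image_atLeastAtMost:
  assumes "l \<le> u"
  shows "along p v ` {l..u} = closed_segment (along p v l) (along p v u)"
proof -
  have "along p v ` closed_segment l u = closed_segment (along p v l) (along p v u)"
    by (simp add: along_image_eq closed_segment_linear_image[OF linear_scaleR_left]
      closed_segment_translation)
  then show ?thesis using assms by (simp add: closed_segment_eq_real_ivl)
qed

lemma base_in_ray: "p \<in> ray p u"
  unfolding ray_def by (force intro: exI[of _ 0])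

lemma convex_union_ray:
  assumes "u \<noteq> 0"
  shows "convex_union 1 (ray p u)"
  unfolding ray_eq_along using assms
  by (intro convex_union_singleton closed_along_image convex_along_image) auto

lemma convex_union_closed_segment:
  fixes a b :: "'a::euclidean_space"
  shows "convex_union 1 (closed_segment a b)"
  by (intro convex_union_singleton) auto

lemma new_regions_le_ray_Int:
  assumes "closed A" "u \<noteq> 0" "convex_union k D" and eq: "ray p u \<inter> A = ray p u \<inter> D"
  shows "new_regions_le k A (A \<union> ray p u)"
proof -
  obtain \<D> where \<D>: "finite \<D>" "card \<D> \<le> k" "\<forall>C\<in>\<D>. closed C \<and> convex C" "D = \<Union>\<D>"
    using assms(3) unfolding convex_union_def by blast
  have "{0..} \<inter> along p u -` A = {0..} \<inter> along p u -` \<Union>\<D>"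
    using eq unfolding ray_eq_along \<D>(4) by blast
  then have "new_regions_le (card {C \<in> \<D>. \<exists>t\<in>{0..}. \<forall>s\<in>{0..}. along p u s \<in> C \<longrightarrow> s < t})
      A (A \<union> ray p u)"
    unfolding ray_eq_along using assms(1,2) \<D>
    by (intro new_regions_le_along_half_line[where a = 0]) auto
  moreover have "card {C \<in> \<D>. \<exists>t\<in>{0..}. \<forall>s\<in>{0..}. along p u s \<in> C \<longrightarrow> s < t} \<le> card \<D>"
    using \<D>(1) by (intro card_mono) auto
  ultimately show ?thesis using \<D>(2) by (meson new_regions_le_mono order_trans)
qed

lemma new_regions_le_ray:
  assumes "convex_union k A" "u \<noteq> 0"
  shows "new_regions_le k A (A \<union> ray p u)"
  using assms closed_convex_union by (intro new_regions_le_ray_Int) auto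

lemma new_regions_le_closed_segment:
  fixes p q :: "'a::euclidean_space"
  assumes "2 \<le> DIM('a)" "convex_union (Suc k) A" "p \<noteq> q" "q \<in> A"
  shows "new_regions_le k A (A \<union> closed_segment p q)"
proof -
  obtain \<C> where \<C>: "finite \<C>" "card \<C> \<le> Suc k" "\<forall>C\<in>\<C>. closed C \<and> convex C" "A = \<Union>\<C>"
    using assms(2) unfolding convex_union_def by blast
  let ?\<gamma> = "along p (q - p)"
  have segment: "closed_segment p q = ?\<gamma> ` {0..1}"
    using along_image_atLeastAtMost[of 0 1 p "q - p"] by simp
  let ?\<B> = "{C \<in> \<C>. \<exists>t\<in>{0..1}. \<forall>s\<in>{0..1}. ?\<gamma> s \<in> C \<longrightarrow> s < t}"
  have "new_regions_le (card ?\<B>) A (A \<union> closed_segment p q)"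
    unfolding segment using assms \<C> closed_convex_union[OF assms(2)]
    by (intro new_regions_le_along_half_line[where a = 0]) auto
  moreover have "card ?\<B> \<le> k"
  proof -
    obtain C where C: "C \<in> \<C>" "q \<in> C" using assms(4) \<C>(4) by blast
    then have "?\<gamma> 1 \<in> C" by simp
    then have "C \<notin> ?\<B>" by (auto intro!: bexI[of _ 1])
    then have "?\<B> \<subseteq> \<C> - {C}" by blast
    then have "card ?\<B> \<le> card (\<C> - {C})" using \<C>(1) by (intro card_mono) auto
    then show ?thesis using C(1) \<C>(1,2) by (simp add: card_Diff_singleton)
  qed
  ultimately show ?thesis by (rule new_regions_le_mono)
qed

section \<open>The upper bound\<close>

definition cuts_like_pieces :: "nat \<Rightarrow> nat \<Rightarrow> (real^2) set \<Rightarrow> bool" where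
  "cuts_like_pieces c d S \<longleftrightarrow> convex_union c S \<and>
     (\<forall>k A. convex_union k A \<longrightarrow> new_regions_le (c * k + d) A (A \<union> S))"

definition region_count :: "nat \<Rightarrow> nat \<Rightarrow> nat \<Rightarrow> nat" where
  "region_count c d n = 1 + (\<Sum>i<n. c * (c * i) + d)"

lemma card_regions_le:
  assumes "\<And>i. i < n \<Longrightarrow> cuts_like_pieces c d (S i)"
  shows "finite (regions n S) \<and> card (regions n S) \<le> region_count c d n"
proof -
  have "convex_union (c * n) (\<Union>i<n. S i) \<and> new_regions_le (\<Sum>i<n. c * (c * i) + d) {} (\<Union>i<n. S i)"
    using assms
  proof (induction n)
    case 0
    then show ?case by (simp add: convex_union_empty new_regions_le_refl)
  next
    case (Suc n)
    let ?A = "\<Union>i<n. S i"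
    have IH: "convex_union (c * n) ?A" "new_regions_le (\<Sum>i<n. c * (c * i) + d) {} ?A"
      using Suc by auto
    have S: "convex_union c (S n)" "new_regions_le (c * (c * n) + d) ?A (?A \<union> S n)"
      using Suc.prems[of n] IH(1) by (auto simp: cuts_like_pieces_def)
    have "(\<Union>i<Suc n. S i) = ?A \<union> S n" by (auto simp: less_Suc_eq)
    then show ?case
      using convex_union_Un[OF IH(1) S(1)] new_regions_le_trans[OF IH(2) S(2)]
      by (simp add: add.commute)
  qed
  then show ?thesis
    by (simp add: new_regions_le_def regions_def region_count_def Compl_eq_Diff_UNIV)
qed

lemma ray_subset:
  assumes "z \<in> ray p u" "z \<in> ray p w" "z \<noteq> p"
  shows "ray p w \<subseteq> ray p u"
proof
  fix y assume "y \<in> ray p w"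
  then obtain r where r: "0 \<le> r" "y = p + r *\<^sub>R w" by (auto simp: ray_def)
  obtain s where s: "0 \<le> s" "z = p + s *\<^sub>R u" using assms(1) by (auto simp: ray_def)
  obtain t where t: "0 \<le> t" "z = p + t *\<^sub>R w" using assms(2) by (auto simp: ray_def)
  have "t \<noteq> 0" using t(2) assms(3) by auto
  have "t *\<^sub>R w = s *\<^sub>R u" using s(2) t(2) by simp
  then have "(1 / t) *\<^sub>R t *\<^sub>R w = (1 / t) *\<^sub>R s *\<^sub>R u" by simp
  then have "w = (s / t) *\<^sub>R u" using \<open>t \<noteq> 0\<close> by simp
  then have "y = p + (r * (s / t)) *\<^sub>R u" using r(2) by simp
  then show "y \<in> ray p u" using r(1) s(1) t(1) by (auto simp: ray_def)
qed

lemma cuts_like_pieces_three_piecesI: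
  fixes P Q R :: "(real^2) set"
  assumes "convex_union 1 P" "convex_union 1 Q" "convex_union 1 R"
    and P: "\<And>k (A :: (real^2) set). convex_union k A \<Longrightarrow> new_regions_le k A (A \<union> P)"
    and Q: "\<And>k (A :: (real^2) set). convex_union k A \<Longrightarrow> new_regions_le (k + i) (A \<union> P) (A \<union> P \<union> Q)"
    and R: "\<And>k (A :: (real^2) set). convex_union k A \<Longrightarrow>
      new_regions_le (k + j) (A \<union> P \<union> Q) (A \<union> P \<union> Q \<union> R)"
    and "i + j = d"
  shows "cuts_like_pieces 3 d (P \<union> Q \<union> R)"
  unfolding cuts_like_pieces_def
proof (intro conjI allI impI)
  show "convex_union 3 (P \<union> Q \<union> R)"
    using convex_union_Un[OF convex_union_Un[OF assms(1,2)] assms(3)] by (simp add: numeral_3_eq_3)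
  fix k and A :: "(real^2) set" assume A: "convex_union k A"
  have "new_regions_le (k + (k + i) + (k + j)) A (A \<union> P \<union> Q \<union> R)"
    using P[OF A] Q[OF A] R[OF A] by (blast intro: new_regions_le_trans)
  moreover have "k + (k + i) + (k + j) = 3 * k + d" using \<open>i + j = d\<close> by simp
  ultimately show "new_regions_le (3 * k + d) A (A \<union> (P \<union> Q \<union> R))"
    by (simp only: Un_assoc)
qed

lemma cuts_like_pieces_three_armed_V:
  assumes "S \<in> three_armed_Vs"
  shows "cuts_like_pieces 3 2 S"
proof -
  obtain p u v w where S: "S = ray p u \<union> ray p v \<union> ray p w" and nz: "u \<noteq> 0" "v \<noteq> 0" "w \<noteq> 0"
    using assms by (auto simp: three_armed_Vs_def)
  note rays = nz[THEN convex_union_ray, of p]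
  show ?thesis
    unfolding S using rays
  proof (rule cuts_like_pieces_three_piecesI[where i = 1 and j = 1])
    fix k and A :: "(real^2) set" assume A: "convex_union k A"
    note A_u = convex_union_Un[OF A rays(1)] and A_v = convex_union_Un[OF A rays(2)]
    show "new_regions_le k A (A \<union> ray p u)" using A nz(1) by (rule new_regions_le_ray)
    show "new_regions_le (k + 1) (A \<union> ray p u) (A \<union> ray p u \<union> ray p v)"
      using A_u nz(2) by (rule new_regions_le_ray)
    show "new_regions_le (k + 1) (A \<union> ray p u \<union> ray p v) (A \<union> ray p u \<union> ray p v \<union> ray p w)"
    proof (cases "ray p w \<subseteq> ray p u")
      case True
      then have "A \<union> ray p u \<union> ray p v \<union> ray p w = A \<union> ray p u \<union> ray p v" by blast
      then show ?thesis by (simp add: new_regions_le_refl)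
    next
      case False
      \<comment> \<open>The third arm meets the first one in the tip alone, which lies on the second arm anyway.\<close>
      then have "ray p w \<inter> ray p u \<subseteq> {p}" using ray_subset[of _ p u w] by blast
      then have "ray p w \<inter> (A \<union> ray p u \<union> ray p v) = ray p w \<inter> (A \<union> ray p v)"
        using base_in_ray[of p v] by auto
      then show ?thesis
        using closed_convex_union[OF convex_union_Un[OF A_u rays(2)]] nz(3) A_v
        by (intro new_regions_le_ray_Int)
    qed
  qed simp
qed

lemma cuts_like_pieces_three_chain:
  assumes "S \<in> three_chains"
  shows "cuts_like_pieces 3 2 S"
proof -
  obtain p q u v where S: "S = ray p u \<union> closed_segment q p \<union> ray q v"
    and nz: "u \<noteq> 0" "v \<noteq> 0" "q \<noteq> p"
    using assms by (auto simp: three_chains_def closed_segment_commute)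
  note pieces = convex_union_ray[OF nz(1), of p] convex_union_closed_segment[of q p]
    convex_union_ray[OF nz(2), of q]
  show ?thesis
    unfolding S using pieces
  proof (rule cuts_like_pieces_three_piecesI[where i = 0 and j = 2])
    fix k and A :: "(real^2) set" assume A: "convex_union k A"
    note A_u = convex_union_Un[OF A pieces(1)]
    show "new_regions_le k A (A \<union> ray p u)" using A nz(1) by (rule new_regions_le_ray)
    show "new_regions_le (k + 0) (A \<union> ray p u) (A \<union> ray p u \<union> closed_segment q p)"
      using A_u nz(3) base_in_ray[of p u] by (intro new_regions_le_closed_segment) auto
    show "new_regions_le (k + 2) (A \<union> ray p u \<union> closed_segment q p)
        (A \<union> ray p u \<union> closed_segment q p \<union> ray q v)"
      using new_regions_le_ray[OF convex_union_Un[OF A_u pieces(2)] nz(2), of q] by simp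
  qed simp
qed

lemma cuts_like_pieces_long_legged_A:
  assumes "S \<in> long_legged_As"
  shows "cuts_like_pieces 3 2 S"
proof -
  obtain p u v a b where S: "S = ray p u \<union> ray p v \<union> closed_segment a b"
    and nz: "u \<noteq> 0" "v \<noteq> 0" "a \<noteq> b" and b: "b \<in> ray p v"
    using assms by (auto simp: long_legged_As_def)
  note pieces = convex_union_ray[OF nz(1), of p] convex_union_ray[OF nz(2), of p]
    convex_union_closed_segment[of a b]
  show ?thesis
    unfolding S using pieces
  proof (rule cuts_like_pieces_three_piecesI[where i = 1 and j = 1])
    fix k and A :: "(real^2) set" assume A: "convex_union k A"
    note A_u = convex_union_Un[OF A pieces(1)]
    show "new_regions_le k A (A \<union> ray p u)" using A nz(1) by (rule new_regions_le_ray)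
    show "new_regions_le (k + 1) (A \<union> ray p u) (A \<union> ray p u \<union> ray p v)"
      using A_u nz(2) by (rule new_regions_le_ray)
    show "new_regions_le (k + 1) (A \<union> ray p u \<union> ray p v) (A \<union> ray p u \<union> ray p v \<union> closed_segment a b)"
      using convex_union_Un[OF A_u pieces(2)] nz(3) b by (intro new_regions_le_closed_segment) auto
  qed simp
qed

section \<open>Arrangements with convex regions\<close>

definition convex_regions :: "'a::euclidean_space set \<Rightarrow> bool" where
  "convex_regions A \<longleftrightarrow> closed A \<and> finite (components (- A)) \<and> (\<forall>C\<in>components (- A). convex C)"

lemma open_connected_meets_hyperplane_iff:
  fixes C :: "'a::euclidean_space set"
  assumes "open C" "connected C" "n \<noteq> 0"
  shows "C \<inter> {x. n \<bullet> x = c} \<noteq> {} \<longleftrightarrow> C \<inter> {x. c < n \<bullet> x} \<noteq> {} \<and> C \<inter> {x. n \<bullet> x < c} \<noteq> {}"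
proof
  assume "C \<inter> {x. n \<bullet> x = c} \<noteq> {}"
  then show "C \<inter> {x. c < n \<bullet> x} \<noteq> {} \<and> C \<inter> {x. n \<bullet> x < c} \<noteq> {}"
    using open_meets_halfspaces[OF assms(1) _ _ assms(3)] by blast
next
  assume "C \<inter> {x. c < n \<bullet> x} \<noteq> {} \<and> C \<inter> {x. n \<bullet> x < c} \<noteq> {}"
  then obtain x y where "x \<in> C" "n \<bullet> x \<le> c" "y \<in> C" "c \<le> n \<bullet> y"
    by force
  then show "C \<inter> {x. n \<bullet> x = c} \<noteq> {}"
    using connected_ivt_hyperplane[OF assms(2)] by blast
qed

lemma components_Compl_Un_hyperplane:
  fixes A :: "'a::euclidean_space set" and n :: 'a and c :: real
  assumes "convex_regions A"
  shows "components (- (A \<union> {x. n \<bullet> x = c})) =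
    (\<lambda>C. C \<inter> {x. c < n \<bullet> x}) ` {C \<in> components (- A). C \<inter> {x. c < n \<bullet> x} \<noteq> {}} \<union>
    (\<lambda>C. C \<inter> {x. n \<bullet> x < c}) ` {C \<in> components (- A). C \<inter> {x. n \<bullet> x < c} \<noteq> {}}" (is "_ = ?\<R>")
proof (rule components_open_unique)
  show "disjoint ?\<R>"
  proof (rule pairwiseI)
    fix X Y assume "X \<in> ?\<R>" "Y \<in> ?\<R>" "X \<noteq> Y"
    have form: "\<exists>C G. X = C \<inter> G \<and> C \<in> components (- A) \<and> (G = {x. c < n \<bullet> x} \<or> G = {x. n \<bullet> x < c})"
      if "X \<in> ?\<R>" for X
      using that by auto
    obtain C G where X: "X = C \<inter> G" "C \<in> components (- A)"
        "G = {x. c < n \<bullet> x} \<or> G = {x. n \<bullet> x < c}"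
      using form[OF \<open>X \<in> ?\<R>\<close>] by auto
    obtain D H where Y: "Y = D \<inter> H" "D \<in> components (- A)"
        "H = {x. c < n \<bullet> x} \<or> H = {x. n \<bullet> x < c}"
      using form[OF \<open>Y \<in> ?\<R>\<close>] by auto
    have "C \<inter> D = {} \<or> G \<noteq> H"
      using X(1) Y(1) \<open>X \<noteq> Y\<close> components_nonoverlap[OF X(2) Y(2)] by blast
    moreover have "G \<inter> H = {}" if "G \<noteq> H"
      using that X(3) Y(3) by auto
    ultimately show "disjnt X Y" by (auto simp: X(1) Y(1) disjnt_def)
  qed
  show "\<Union>?\<R> = - (A \<union> {x. n \<bullet> x = c})"
  proof (rule set_eqI)
    fix x
    have "x \<in> \<Union>?\<R> \<longleftrightarrow> (\<exists>C\<in>components (- A). x \<in> C \<and> (c < n \<bullet> x \<or> n \<bullet> x < c))"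
      by auto
    also have "\<dots> \<longleftrightarrow> x \<in> \<Union>(components (- A)) \<and> n \<bullet> x \<noteq> c"
      unfolding neq_iff by blast
    finally show "x \<in> \<Union>?\<R> \<longleftrightarrow> x \<in> - (A \<union> {x. n \<bullet> x = c})" by simp
  qed
  fix X assume X: "X \<in> ?\<R>"
  have "open C" "convex C" if "C \<in> components (- A)" for C
    using assms that open_components[of "- A"] by (auto simp: convex_regions_def)
  then show "open X \<and> connected X \<and> X \<noteq> {}"
    using X by (auto intro!: convex_connected convex_Int open_Int convex_halfspace_gt
      convex_halfspace_lt open_halfspace_gt open_halfspace_lt)
qed

lemma convex_regions_Un_hyperplane:
  fixes A :: "'a::euclidean_space set"
  assumes "convex_regions A"
  shows "convex_regions (A \<union> {x. n \<bullet> x = c})"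
proof -
  note components_eq = components_Compl_Un_hyperplane[OF assms, of n c]
  have "convex X" if X: "X \<in> components (- (A \<union> {x. n \<bullet> x = c}))" for X
  proof -
    obtain C where "C \<in> components (- A)" "X = C \<inter> {x. c < n \<bullet> x} \<or> X = C \<inter> {x. n \<bullet> x < c}"
      using X unfolding components_eq by auto
    then show ?thesis
      using assms
      by (auto simp: convex_regions_def intro!: convex_Int convex_halfspace_gt convex_halfspace_lt)
  qed
  moreover have "finite (components (- (A \<union> {x. n \<bullet> x = c})))"
    unfolding components_eq using assms by (simp add: convex_regions_def)
  ultimately show ?thesis
    using assms by (simp add: convex_regions_def closed_hyperplane closed_Un)
qed

theorem card_components_Compl_Un_hyperplane:
  fixes A :: "'a::euclidean_space set" and n :: 'a and c :: real
  assumes A: "convex_regions A" and "n \<noteq> 0"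
  shows "card (components (- (A \<union> {x. n \<bullet> x = c}))) =
    card (components (- A)) + card {C \<in> components (- A). C \<inter> {x. n \<bullet> x = c} \<noteq> {}}"
proof -
  define above below where "above = {x. c < n \<bullet> x}" and "below = {x. n \<bullet> x < c}"
  define \<P> where "\<P> = {C \<in> components (- A). C \<inter> above \<noteq> {}}"
  define \<N> where "\<N> = {C \<in> components (- A). C \<inter> below \<noteq> {}}"
  have C: "open C" "connected C" if "C \<in> components (- A)" for C
    using A that open_components[of "- A" C] in_components_connected[OF that]
    by (auto simp: convex_regions_def)
  have fin: "finite \<P>" "finite \<N>" using A by (auto simp: \<P>_def \<N>_def convex_regions_def)
  have inj: "inj_on (\<lambda>C. C \<inter> H) {C \<in> components (- A). C \<inter> H \<noteq> {}}" for H :: "'a set"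
    by (rule inj_onI) (use components_nonoverlap[of _ "- A"] in blast)
  have "components (- (A \<union> {x. n \<bullet> x = c})) = (\<lambda>C. C \<inter> above) ` \<P> \<union> (\<lambda>C. C \<inter> below) ` \<N>"
    unfolding \<P>_def \<N>_def above_def below_def using A by (rule components_Compl_Un_hyperplane)
  moreover have "(\<lambda>C. C \<inter> above) ` \<P> \<inter> (\<lambda>C. C \<inter> below) ` \<N> = {}"
    by (auto simp: \<P>_def above_def below_def)
  ultimately have "card (components (- (A \<union> {x. n \<bullet> x = c}))) = card \<P> + card \<N>"
    using fin inj by (simp add: card_Un_disjoint card_image \<P>_def \<N>_def)
  also have "\<dots> = card (\<P> \<union> \<N>) + card (\<P> \<inter> \<N>)"
    using fin by (rule card_Un_Int)
  also have "\<P> \<inter> \<N> = {C \<in> components (- A). C \<inter> {x. n \<bullet> x = c} \<noteq> {}}"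
    using open_connected_meets_hyperplane_iff[OF C \<open>n \<noteq> 0\<close>]
    unfolding \<P>_def \<N>_def above_def below_def by blast
  also have "\<P> \<union> \<N> = components (- A)"
  proof -
    have "C \<inter> above \<noteq> {} \<or> C \<inter> below \<noteq> {}" if "C \<in> components (- A)" for C
    proof -
      obtain z where "z \<in> C" using in_components_nonempty \<open>C \<in> components (- A)\<close> by blast
      then show ?thesis
        using open_meets_halfspaces[OF C(1)[OF that], of z n c] \<open>n \<noteq> 0\<close>
        unfolding above_def below_def by (cases "n \<bullet> z" c rule: linorder_cases) auto
    qed
    then show ?thesis by (auto simp: \<P>_def \<N>_def)
  qed
  finally show ?thesis .
qed

lemma card_components_Compl_vimage_along:
  fixes p v :: "'a::euclidean_space"
  assumes A: "convex_regions A" and "v \<noteq> 0"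
  shows "card (components (- (along p v -` A))) =
    card {C \<in> components (- A). C \<inter> range (along p v) \<noteq> {}}"
proof -
  define \<M> where "\<M> = {C \<in> components (- A). C \<inter> range (along p v) \<noteq> {}}"
  have C: "open C" "convex C" if "C \<in> components (- A)" for C
    using A that open_components[of "- A" C] by (auto simp: convex_regions_def)
  have inj: "inj_on ((-`) (along p v)) \<M>"
  proof (rule inj_onI)
    fix C D assume CD: "C \<in> \<M>" "D \<in> \<M>" "along p v -` C = along p v -` D"
    then have "C \<inter> D \<noteq> {}" by (auto simp: \<M>_def)
    then show "C = D" using CD(1,2) components_eq by (auto simp: \<M>_def)
  qed
  have "components (- (along p v -` A)) = (-`) (along p v) ` \<M>"
  proof (rule components_open_unique)
    show "disjoint ((-`) (along p v) ` \<M>)"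
      using components_nonoverlap[of _ "- A"] by (force simp: \<M>_def pairwise_def disjnt_def)
    have "\<Union>((-`) (along p v) ` \<M>) = (\<Union>C\<in>components (- A). along p v -` C)"
      by (auto simp: \<M>_def)
    also have "\<dots> = along p v -` \<Union>(components (- A))"
      by (simp only: vimage_Union)
    finally show "\<Union>((-`) (along p v) ` \<M>) = - (along p v -` A)"
      by (simp add: vimage_Compl)
    show "open X \<and> connected X \<and> X \<noteq> {}" if "X \<in> (-`) (along p v) ` \<M>" for X
      using that C by (auto simp: \<M>_def open_along_vimage intro!: convex_connected convex_along_vimage)
  qed
  then show ?thesis using card_image[OF inj] by (simp add: \<M>_def)
qed

lemma finite_card_components_Compl_real:
  fixes X :: "real set"
  assumes "finite X"
  shows "convex_regions X \<and> card (components (- X)) = card X + 1"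
  using assms
proof (induction X rule: finite_induct)
  case empty
  then show ?case by (simp add: convex_regions_def)
next
  case (insert b X)
  have "{C \<in> components (- X). C \<inter> {x. 1 \<bullet> x = b} \<noteq> {}} = {connected_component_set (- X) b}"
    using insert.hyps(2) connected_component_eq by (fastforce simp: components_def)
  then show ?case
    using insert convex_regions_Un_hyperplane[of X 1 b] card_components_Compl_Un_hyperplane[of X 1 b]
    by simp
qed

section \<open>Lines in the plane\<close>

abbreviation graph_point :: "real \<Rightarrow> real \<Rightarrow> real \<Rightarrow> real^2" where
  "graph_point a b \<equiv> along (vector [0, b]) (vector [1, a])"

abbreviation line_pieces ::
    "('i \<Rightarrow> real) \<Rightarrow> ('i \<Rightarrow> real) \<Rightarrow> ('i \<Rightarrow> real set) \<Rightarrow> 'i set \<Rightarrow> (real^2) set" where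
  "line_pieces a b I K \<equiv> \<Union>k\<in>K. graph_point (a k) (b k) ` I k"

abbreviation line_union :: "('i \<Rightarrow> real) \<Rightarrow> ('i \<Rightarrow> real) \<Rightarrow> 'i set \<Rightarrow> (real^2) set" where
  "line_union a b K \<equiv> line_pieces a b (\<lambda>_. UNIV) K"

definition crossings :: "('i \<Rightarrow> real) \<Rightarrow> ('i \<Rightarrow> real) \<Rightarrow> 'i set \<Rightarrow> 'i \<Rightarrow> real set" where
  "crossings a b K k = {x. \<exists>l\<in>K. a k * x + b k = a l * x + b l}"

lemma graph_point_nth: "graph_point a b x $ 1 = x" "graph_point a b x $ 2 = a * x + b"
  by simp_all

lemma slope_vector_nonzero [simp]: "(vector [1, a] :: real^2) \<noteq> 0"
  by (metis vector_2(1) zero_index zero_neq_one)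

lemma graph_point_eq_iff:
  "graph_point a b x = graph_point a' b' x' \<longleftrightarrow> x = x' \<and> a * x + b = a' * x' + b'"
  unfolding vec_eq_iff forall_2 graph_point_nth ..

lemma graph_point_in_image_iff:
  "graph_point a b x \<in> graph_point a' b' ` I \<longleftrightarrow> x \<in> I \<and> a * x + b = a' * x + b'"
  unfolding image_iff graph_point_eq_iff by auto

lemma range_graph_point: "range (graph_point a b) = {z. vector [- a, 1] \<bullet> z = b}"
proof (rule set_eqI)
  fix z :: "real^2"
  have "z \<in> range (graph_point a b) \<longleftrightarrow> (\<exists>x. z = graph_point a b x)" by blast
  also have "\<dots> \<longleftrightarrow> (\<exists>x. z $ 1 = x \<and> z $ 2 = a * x + b)"
    unfolding vec_eq_iff forall_2 graph_point_nth ..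
  finally show "z \<in> range (graph_point a b) \<longleftrightarrow> z \<in> {z. vector [- a, 1] \<bullet> z = b}"
    by (auto simp: inner_vec_def sum_2)
qed

lemma crossings_eq_image:
  assumes "\<And>l. l \<in> K \<Longrightarrow> a l \<noteq> a k"
  shows "crossings a b K k = (\<lambda>l. (b k - b l) / (a l - a k)) ` K"
proof -
  have "a k * x + b k = a l * x + b l \<longleftrightarrow> x = (b k - b l) / (a l - a k)" if "l \<in> K" for l x
    using assms[OF that] by (auto simp: eq_divide_eq algebra_simps)
  then show ?thesis by (auto simp: crossings_def)
qed

lemma finite_crossings:
  "finite K \<Longrightarrow> (\<And>l. l \<in> K \<Longrightarrow> a l \<noteq> a k) \<Longrightarrow> finite (crossings a b K k)"
  by (simp add: crossings_eq_image)

lemma card_regions_insert_line: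
  fixes a b :: "'i \<Rightarrow> real"
  assumes "finite K" "\<And>l. l \<in> K \<Longrightarrow> a l \<noteq> a k" and convex: "convex_regions (line_union a b K)"
  shows "convex_regions (line_union a b (insert k K)) \<and>
    card (components (- line_union a b (insert k K))) =
      card (components (- line_union a b K)) + (card (crossings a b K k) + 1)"
proof -
  let ?\<gamma> = "graph_point (a k) (b k)"
  have insert: "line_union a b (insert k K) = line_union a b K \<union> {z. vector [- a k, 1] \<bullet> z = b k}"
    unfolding range_graph_point by blast
  have "?\<gamma> -` line_union a b K = crossings a b K k"
    unfolding crossings_def vimage_def UN_iff graph_point_in_image_iff by simp
  moreover have "finite (crossings a b K k)"
    using assms(1,2) by (rule finite_crossings)
  ultimately have "card {C \<in> components (- line_union a b K). C \<inter> range ?\<gamma> \<noteq> {}} =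
      card (crossings a b K k) + 1"
    using card_components_Compl_vimage_along[OF convex, of "vector [1, a k]" "vector [0, b k]"]
      finite_card_components_Compl_real[of "crossings a b K k"] by simp
  moreover have "(vector [- a k, 1] :: real^2) \<noteq> 0"
    by (metis vector_2(2) zero_index zero_neq_one)
  ultimately show ?thesis
    unfolding insert using convex_regions_Un_hyperplane[OF convex]
      card_components_Compl_Un_hyperplane[OF convex] by (simp add: range_graph_point)
qed

text \<open>All crossings lie on the pieces, so each missing end of a line is a single gap.\<close>

lemma vimage_line_pieces_Un_lines:
  fixes a b :: "'i \<Rightarrow> real" and I :: "'i \<Rightarrow> real set"
  assumes "k \<in> K" "L \<subseteq> K" "k \<notin> L"
    and cross: "\<And>l x. \<lbrakk>l \<in> K; l \<noteq> k; a k * x + b k = a l * x + b l\<rbrakk> \<Longrightarrow> x \<in> I k"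
  shows "graph_point (a k) (b k) -` (line_pieces a b I K \<union> line_union a b L) = I k"
proof (intro equalityI subsetI)
  fix x assume "x \<in> graph_point (a k) (b k) -` (line_pieces a b I K \<union> line_union a b L)"
  then obtain l where "l \<in> K" "l \<in> L \<or> x \<in> I l" "a k * x + b k = a l * x + b l"
    using \<open>L \<subseteq> K\<close>
    unfolding vimage_def Un_iff UN_iff mem_Collect_eq graph_point_in_image_iff by blast
  then show "x \<in> I k" using \<open>k \<notin> L\<close> cross[of l x] by (cases "l = k") auto
next
  fix x assume "x \<in> I k"
  then show "x \<in> graph_point (a k) (b k) -` (line_pieces a b I K \<union> line_union a b L)"
    using \<open>k \<in> K\<close> by blast
qed

lemma new_regions_le_extend_lines:
  fixes a b :: "'i \<Rightarrow> real" and I :: "'i \<Rightarrow> real set"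
  assumes "finite K" and I: "\<And>k. k \<in> K \<Longrightarrow> closed (I k)" "\<And>k. k \<in> K \<Longrightarrow> finite (components (- I k))"
    and cross: "\<And>k l x. \<lbrakk>k \<in> K; l \<in> K; l \<noteq> k; a k * x + b k = a l * x + b l\<rbrakk> \<Longrightarrow> x \<in> I k"
  shows "new_regions_le (\<Sum>k\<in>K. card (components (- I k))) (line_pieces a b I K) (line_union a b K)"
proof -
  have partial: "new_regions_le (\<Sum>k\<in>L. card (components (- I k)))
      (line_pieces a b I K) (line_pieces a b I K \<union> line_union a b L)" if "L \<subseteq> K" for L
    using finite_subset[OF that \<open>finite K\<close>] that
  proof (induction L rule: finite_subset_induct')
    case empty
    then show ?case by (simp add: new_regions_le_refl)
  next
    case (insert k L)
    let ?\<gamma> = "graph_point (a k) (b k)" and ?A = "line_pieces a b I K \<union> line_union a b L"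
    have "closed ?A"
      using \<open>finite K\<close> I(1) insert.hyps(1) by (intro closed_Un closed_UN ballI closed_along_image) auto
    moreover have "?\<gamma> -` ?A = I k"
      using insert.hyps(2-4) cross by (intro vimage_line_pieces_Un_lines) auto
    ultimately have "new_regions_le (card (components (- I k))) ?A (?A \<union> range ?\<gamma>)"
      using new_regions_le_range_along[of "vector [1, a k]" ?A "vector [0, b k]"] I(2)[OF insert.hyps(2)]
      by simp
    from new_regions_le_trans[OF insert.IH this] show ?case
      using insert.hyps(1,4) by (simp add: Un_ac add.commute)
  qed
  have "line_pieces a b I K \<union> line_union a b K = line_union a b K" by blast
  then show ?thesis using partial[OF order_refl] by simp
qed

section \<open>Clusters of lines\<close>

text \<open>Line \<open>(i, j)\<close> is the \<open>j\<close>-th line of cluster \<open>i\<close>; lines of the clusters \<open>i\<close> and \<open>i'\<close> cross near the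
  abscissa \<open>(i + i') / 2\<close>, as the tangents to the parabola \<open>y = x\<^sup>2\<close> over \<open>i\<close> and \<open>i'\<close> do.\<close>

definition separated_clusters :: "nat \<Rightarrow> nat \<Rightarrow> (nat \<times> nat \<Rightarrow> real) \<Rightarrow> (nat \<times> nat \<Rightarrow> real) \<Rightarrow> bool" where
  "separated_clusters n c a b \<longleftrightarrow>
     (\<forall>i\<in>{..<n}. \<forall>i'\<in>{..<n} - {i}. \<forall>j\<in>{..<c}. \<forall>j'\<in>{..<c}. a (i, j) \<noteq> a (i', j') \<and>
        (\<forall>x. a (i, j) * x + b (i, j) = a (i', j') * x + b (i', j') \<longrightarrow>
          \<bar>x - (real i + real i') / 2\<bar> < 1 / 4))"

locale line_clusters =
  fixes n c :: nat and a b :: "nat \<times> nat \<Rightarrow> real" and I :: "nat \<Rightarrow> real set" and v :: "nat \<Rightarrow> nat"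
  assumes separated: "separated_clusters n c a b"
    and inj_slopes: "i < n \<Longrightarrow> inj_on (\<lambda>j. a (i, j)) {..<c}"
    and vertex: "\<lbrakk>i < n; j < c; j' < c; j \<noteq> j'; a (i, j) * x + b (i, j) = a (i, j') * x + b (i, j')\<rbrakk>
      \<Longrightarrow> x \<in> I j - {0<..<real n}"
    and card_vertices: "\<lbrakk>i < n; j < c\<rbrakk> \<Longrightarrow> card (crossings a b ({i} \<times> {..<j}) (i, j)) = v j"
    and piece: "j < c \<Longrightarrow> closed (I j) \<and> finite (components (- I j)) \<and> {0<..<real n} \<subseteq> I j"
begin

abbreviation lines :: "(nat \<times> nat) set \<Rightarrow> (real^2) set" where
  "lines K \<equiv> line_union a b K"

lemma cluster_crossing_near:
  assumes "i < n" "i' < n" "j < c" "j' < c" "i \<noteq> i'"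
    and "a (i, j) * x + b (i, j) = a (i', j') * x + b (i', j')"
  shows "\<bar>x - (real i + real i') / 2\<bar> < 1 / 4"
  using separated assms unfolding separated_clusters_def by blast

lemma cluster_crossing_between:
  assumes "i < n" "i' < n" "j < c" "j' < c" "i \<noteq> i'"
    and "a (i, j) * x + b (i, j) = a (i', j') * x + b (i', j')"
  shows "x \<in> {0<..<real n}"
proof -
  have "1 \<le> i + i'" "i + i' + 1 \<le> 2 * n - 1" using assms(1,2,5) by auto
  then have "1 \<le> real i + real i'" "real i + real i' + 1 \<le> 2 * real n - 1" using assms(1) by linarith+
  moreover have "\<bar>x - (real i + real i') / 2\<bar> < 1 / 4" using assms by (rule cluster_crossing_near)
  ultimately show ?thesis unfolding abs_less_iff add_divide_distrib by simp
qed

lemma distinct_slopes: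
  assumes "i < n" "i' < n" "j < c" "j' < c" "(i, j) \<noteq> (i', j')"
  shows "a (i, j) \<noteq> a (i', j')"
proof (cases "i = i'")
  case True
  then show ?thesis using inj_onD[OF inj_slopes[OF assms(1)], of j j'] assms by auto
next
  case False
  then show ?thesis using separated assms unfolding separated_clusters_def by blast
qed

lemma earlier_slope_neq:
  assumes "i < n" "j < c" "l \<in> {..<i} \<times> {..<c} \<union> {i} \<times> {..<j}"
  shows "a l \<noteq> a (i, j)"
  using assms distinct_slopes by auto

lemma crossing_in_piece:
  assumes "i < n" "i' < n" "j < c" "j' < c" "(i, j) \<noteq> (i', j')"
    and eq: "a (i, j) * x + b (i, j) = a (i', j') * x + b (i', j')"
  shows "x \<in> I j"
proof (cases "i = i'")
  case True
  then show ?thesis using vertex[of i j j' x] assms by auto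
next
  case False
  then show ?thesis using cluster_crossing_between[OF assms(1-4) False eq] piece[OF assms(3)] by blast
qed

lemma card_crossings_earlier_clusters:
  assumes "i < n" "j < c"
  shows "card (crossings a b ({..<i} \<times> {..<c}) (i, j)) = c * i"
proof -
  define x where "x l = (b (i, j) - b l) / (a l - a (i, j))" for l
  have slopes: "a l \<noteq> a (i, j)" if "l \<in> {..<i} \<times> {..<c}" for l
    using that earlier_slope_neq[OF assms] by blast
  then have cross: "a (i, j) * x l + b (i, j) = a l * x l + b l" if "l \<in> {..<i} \<times> {..<c}" for l
    using that by (auto simp: x_def field_simps)
  have "inj_on x ({..<i} \<times> {..<c})"
  proof (rule inj_onI, rule ccontr)
    fix k l assume k: "k \<in> {..<i} \<times> {..<c}" and l: "l \<in> {..<i} \<times> {..<c}" and "x k = x l" "k \<noteq> l"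
    obtain i1 j1 i2 j2 where kl: "k = (i1, j1)" "i1 < i" "j1 < c" "l = (i2, j2)" "i2 < i" "j2 < c"
      using k l by auto
    note crosses = cross[OF k, unfolded kl(1)] cross[OF l, folded \<open>x k = x l\<close>, unfolded kl(1,4)]
    show False
    proof (cases "i1 = i2")
      case True
      then have "x (i1, j1) \<notin> {0<..<real n}"
        using vertex[of i1 j1 j2 "x (i1, j1)"] crosses kl assms(1) \<open>k \<noteq> l\<close> by auto
      moreover have "x (i1, j1) \<in> {0<..<real n}"
        using cluster_crossing_between[OF _ _ _ _ _ crosses(1)] kl assms by simp
      ultimately show ?thesis by blast
    next
      case False
      have "\<bar>x (i1, j1) - (real i + real i1) / 2\<bar> < 1 / 4"
        "\<bar>x (i1, j1) - (real i + real i2) / 2\<bar> < 1 / 4"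
        using crosses[THEN cluster_crossing_near[rotated 5]] kl assms by simp_all
      moreover have "1 \<le> \<bar>real i1 - real i2\<bar>" using False by simp
      ultimately show ?thesis unfolding add_divide_distrib by linarith
    qed
  qed
  moreover have "crossings a b ({..<i} \<times> {..<c}) (i, j) = x ` ({..<i} \<times> {..<c})"
    unfolding x_def using slopes by (rule crossings_eq_image)
  ultimately show ?thesis by (simp add: card_image card_cartesian_product)
qed

lemma card_crossings_ge:
  assumes "i < n" "j < c"
  shows "c * i + v j \<le> card (crossings a b ({..<i} \<times> {..<c} \<union> {i} \<times> {..<j}) (i, j))"
proof -
  let ?X = "crossings a b ({..<i} \<times> {..<c}) (i, j)" and ?Y = "crossings a b ({i} \<times> {..<j}) (i, j)"
  have "x \<in> {0<..<real n}" if X: "x \<in> ?X" for x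
  proof -
    obtain i' j' where "i' < i" "j' < c" "a (i, j) * x + b (i, j) = a (i', j') * x + b (i', j')"
      using X by (auto simp: crossings_def)
    then show ?thesis using assms by (intro cluster_crossing_between[of i i' j j']) auto
  qed
  moreover have "x \<notin> {0<..<real n}" if Y: "x \<in> ?Y" for x
  proof -
    obtain j' where "j' < j" "a (i, j) * x + b (i, j) = a (i, j') * x + b (i, j')"
      using Y by (auto simp: crossings_def)
    then show ?thesis using assms vertex[of i j j' x] by simp
  qed
  ultimately have "?X \<inter> ?Y = {}" by blast
  moreover have "finite ?X" "finite ?Y"
    using earlier_slope_neq[OF assms] by (auto intro!: finite_crossings)
  ultimately have "c * i + v j = card (?X \<union> ?Y)"
    using card_crossings_earlier_clusters[OF assms] card_vertices[OF assms]
    by (simp add: card_Un_disjoint)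
  also have "?X \<union> ?Y = crossings a b ({..<i} \<times> {..<c} \<union> {i} \<times> {..<j}) (i, j)"
    by (auto simp: crossings_def)
  finally show ?thesis by simp
qed

lemma card_regions_add_cluster:
  assumes "i < n" "j \<le> c" and convex: "convex_regions (lines ({..<i} \<times> {..<c}))"
  shows "convex_regions (lines ({..<i} \<times> {..<c} \<union> {i} \<times> {..<j})) \<and>
    card (components (- lines ({..<i} \<times> {..<c}))) + (\<Sum>j<j. c * i + v j + 1)
      \<le> card (components (- lines ({..<i} \<times> {..<c} \<union> {i} \<times> {..<j})))"
  using \<open>j \<le> c\<close>
proof (induction j)
  case 0
  then show ?case using convex by simp
next
  case (Suc j)
  let ?K = "{..<i} \<times> {..<c} \<union> {i} \<times> {..<j}"
  have insert: "insert (i, j) ?K = {..<i} \<times> {..<c} \<union> {i} \<times> {..<Suc j}" by auto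
  have "a l \<noteq> a (i, j)" if "l \<in> ?K" for l
    using earlier_slope_neq[of i j l] that assms(1) Suc.prems by simp
  then have "convex_regions (lines (insert (i, j) ?K)) \<and> card (components (- lines (insert (i, j) ?K)))
      = card (components (- lines ?K)) + (card (crossings a b ?K (i, j)) + 1)"
    using Suc.IH Suc.prems by (intro card_regions_insert_line) auto
  moreover have "c * i + v j \<le> card (crossings a b ?K (i, j))"
    using assms(1) Suc.prems by (intro card_crossings_ge) auto
  ultimately show ?case unfolding insert using Suc by simp
qed

lemma card_regions_lines_ge:
  assumes "m \<le> n"
  shows "convex_regions (lines ({..<m} \<times> {..<c})) \<and>
    1 + (\<Sum>i<m. \<Sum>j<c. c * i + v j + 1) \<le> card (components (- lines ({..<m} \<times> {..<c})))"
  using assms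
proof (induction m)
  case 0
  then show ?case by (simp add: convex_regions_def)
next
  case (Suc m)
  have "{..<Suc m} \<times> {..<c} = {..<m} \<times> {..<c} \<union> {m} \<times> {..<c}" by auto
  then show ?case using Suc card_regions_add_cluster[of m c] by simp
qed

theorem card_regions_clusters_ge:
  defines "drawn \<equiv> \<Union>i<n. \<Union>j<c. graph_point (a (i, j)) (b (i, j)) ` I j"
  assumes fin: "finite (components (- drawn))"
    and ends: "(\<Sum>j<c. card (components (- I j))) + d \<le> (\<Sum>j<c. v j) + c"
  shows "region_count c d n \<le> card (components (- drawn))"
proof -
  let ?e = "\<Sum>j<c. card (components (- I j))"
  have "drawn = line_pieces a b (\<lambda>k. I (snd k)) ({..<n} \<times> {..<c})"
    unfolding drawn_def by force
  moreover have "new_regions_le (\<Sum>k\<in>{..<n} \<times> {..<c}. card (components (- I (snd k))))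
      (line_pieces a b (\<lambda>k. I (snd k)) ({..<n} \<times> {..<c})) (lines ({..<n} \<times> {..<c}))"
  proof (rule new_regions_le_extend_lines)
    fix k l x
    assume "k \<in> {..<n} \<times> {..<c}" "l \<in> {..<n} \<times> {..<c}" "l \<noteq> k" "a k * x + b k = a l * x + b l"
    then show "x \<in> I (snd k)"
      using crossing_in_piece[of "fst k" "fst l" "snd k" "snd l" x] by (auto simp: mem_Times_iff)
  qed (use piece in auto)
  moreover have "(\<Sum>k\<in>{..<n} \<times> {..<c}. card (components (- I (snd k)))) = n * ?e"
    by (simp add: sum.cartesian_product')
  ultimately have "card (components (- lines ({..<n} \<times> {..<c}))) \<le> card (components (- drawn)) + n * ?e"
    using fin by (simp add: new_regions_le_def)
  moreover have "1 + (\<Sum>i<n. \<Sum>j<c. c * i + v j + 1) \<le> card (components (- lines ({..<n} \<times> {..<c})))"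
    using card_regions_lines_ge by blast
  moreover have "(\<Sum>i<n. c * (c * i) + d) + n * ?e \<le> (\<Sum>i<n. \<Sum>j<c. c * i + v j + 1)"
  proof -
    have "c * (c * i) + d + ?e \<le> (\<Sum>j<c. c * i + v j + 1)" for i
      using ends by (simp add: sum.distrib sum_Suc)
    then have "(\<Sum>i<n. c * (c * i) + d + ?e) \<le> (\<Sum>i<n. \<Sum>j<c. c * i + v j + 1)"
      by (rule sum_mono)
    then show ?thesis by (simp add: sum.distrib)
  qed
  ultimately show ?thesis unfolding region_count_def by linarith
qed

end

section \<open>Perturbed tangents of a parabola\<close>

definition tangent_slope :: "real \<Rightarrow> (nat \<Rightarrow> real) \<Rightarrow> nat \<times> nat \<Rightarrow> real" where
  "tangent_slope \<epsilon> \<alpha> = (\<lambda>(i, j). 2 * real i + \<epsilon> * \<alpha> j)"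

definition tangent_intercept :: "real \<Rightarrow> (nat \<Rightarrow> real) \<Rightarrow> nat \<times> nat \<Rightarrow> real" where
  "tangent_intercept \<epsilon> \<beta> = (\<lambda>(i, j). - (real i)\<^sup>2 + \<epsilon> * \<beta> j)"

lemma eventually_tangents_cross_near:
  fixes i i' j j' :: nat and \<alpha> \<beta> :: "nat \<Rightarrow> real"
  assumes "i \<noteq> i'"
  defines "a \<equiv> \<lambda>\<epsilon>. tangent_slope \<epsilon> \<alpha>" and "b \<equiv> \<lambda>\<epsilon>. tangent_intercept \<epsilon> \<beta>"
  shows "\<forall>\<^sub>F \<epsilon> in at_right 0. a \<epsilon> (i, j) \<noteq> a \<epsilon> (i', j') \<and>
    (\<forall>x. a \<epsilon> (i, j) * x + b \<epsilon> (i, j) = a \<epsilon> (i', j') * x + b \<epsilon> (i', j') \<longrightarrow>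
      \<bar>x - (real i + real i') / 2\<bar> < 1 / 4)"
proof -
  define s where "s \<epsilon> = a \<epsilon> (i, j) - a \<epsilon> (i', j')" for \<epsilon>
  define t where "t \<epsilon> = b \<epsilon> (i', j') - b \<epsilon> (i, j)" for \<epsilon>
  have "(s \<longlongrightarrow> s 0) (at_right 0)" "(t \<longlongrightarrow> t 0) (at_right 0)"
    unfolding s_def t_def a_def b_def tangent_slope_def tangent_intercept_def case_prod_conv
    by (intro tendsto_intros)+
  moreover have "s 0 \<noteq> 0" using \<open>i \<noteq> i'\<close> by (simp add: s_def a_def tangent_slope_def)
  moreover have "t 0 / s 0 = (real i + real i') / 2"
    using \<open>i \<noteq> i'\<close> by (simp add: s_def t_def a_def b_def tangent_slope_def tangent_intercept_def
      divide_simps power2_eq_square) (simp add: algebra_simps)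
  ultimately have "((\<lambda>\<epsilon>. t \<epsilon> / s \<epsilon>) \<longlongrightarrow> (real i + real i') / 2) (at_right 0)"
    using tendsto_divide by metis
  then have "\<forall>\<^sub>F \<epsilon> in at_right 0. dist (t \<epsilon> / s \<epsilon>) ((real i + real i') / 2) < 1 / 4"
    by (rule tendstoD) simp
  moreover have "\<forall>\<^sub>F \<epsilon> in at_right 0. s \<epsilon> \<noteq> 0"
    using \<open>(s \<longlongrightarrow> s 0) (at_right 0)\<close> \<open>s 0 \<noteq> 0\<close> by (rule tendsto_imp_eventually_ne)
  ultimately show ?thesis
  proof eventually_elim
    case (elim \<epsilon>)
    have "x = t \<epsilon> / s \<epsilon>" if "a \<epsilon> (i, j) * x + b \<epsilon> (i, j) = a \<epsilon> (i', j') * x + b \<epsilon> (i', j')" for x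
      using that elim(2) by (simp add: s_def t_def eq_divide_eq algebra_simps)
    then show ?case using elim by (auto simp: s_def dist_real_def)
  qed
qed

lemma ex_separated_tangents:
  obtains \<epsilon> where "0 < \<epsilon>" "separated_clusters n c (tangent_slope \<epsilon> \<alpha>) (tangent_intercept \<epsilon> \<beta>)"
proof -
  have "\<forall>\<^sub>F \<epsilon> in at_right 0. separated_clusters n c (tangent_slope \<epsilon> \<alpha>) (tangent_intercept \<epsilon> \<beta>)"
    unfolding separated_clusters_def
    by (intro eventually_ball_finite ballI finite_lessThan finite_Diff
      eventually_tangents_cross_near) auto
  moreover have "\<forall>\<^sub>F \<epsilon> in at_right (0::real). 0 < \<epsilon>"
    by (rule eventually_at_right_less)
  ultimately have "\<forall>\<^sub>F \<epsilon> in at_right 0. 0 < \<epsilon> \<and>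
      separated_clusters n c (tangent_slope \<epsilon> \<alpha>) (tangent_intercept \<epsilon> \<beta>)"
    by eventually_elim simp
  then show thesis
    using that eventually_happens'[OF trivial_limit_at_right_real] by blast
qed

lemma tangents_meet_iff:
  fixes i j j' :: nat and \<alpha> \<beta> :: "nat \<Rightarrow> real"
  assumes "\<epsilon> \<noteq> 0"
  defines "a \<equiv> tangent_slope \<epsilon> \<alpha>" and "b \<equiv> tangent_intercept \<epsilon> \<beta>"
  shows "a (i, j) * x + b (i, j) = a (i, j') * x + b (i, j') \<longleftrightarrow> \<alpha> j * x + \<beta> j = \<alpha> j' * x + \<beta> j'"
proof -
  have "a (i, j) * x + b (i, j) = 2 * real i * x - (real i)\<^sup>2 + \<epsilon> * (\<alpha> j * x + \<beta> j)" for j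
    by (simp add: a_def b_def tangent_slope_def tangent_intercept_def algebra_simps)
  then show ?thesis using \<open>\<epsilon> \<noteq> 0\<close> by simp
qed

lemma line_clusters_tangents:
  fixes \<alpha> \<beta> :: "nat \<Rightarrow> real" and I :: "nat \<Rightarrow> real set"
  assumes \<epsilon>: "0 < \<epsilon>" "separated_clusters n c (tangent_slope \<epsilon> \<alpha>) (tangent_intercept \<epsilon> \<beta>)"
    and slopes: "inj_on \<alpha> {..<c}"
    and vertex: "\<And>j j' x. \<lbrakk>j < c; j' < c; j \<noteq> j'; \<alpha> j * x + \<beta> j = \<alpha> j' * x + \<beta> j'\<rbrakk>
      \<Longrightarrow> x \<in> I j - {0<..<real n}"
    and piece: "\<And>j. j < c \<Longrightarrow> closed (I j) \<and> finite (components (- I j)) \<and> {0<..<real n} \<subseteq> I j"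
  shows "line_clusters n c (tangent_slope \<epsilon> \<alpha>) (tangent_intercept \<epsilon> \<beta>) I
    (\<lambda>j. card (crossings \<alpha> \<beta> {..<j} j))"
proof
  have "\<epsilon> \<noteq> 0" using \<epsilon>(1) by simp
  note meet_iff = tangents_meet_iff[OF this]
  show "inj_on (\<lambda>j. tangent_slope \<epsilon> \<alpha> (i, j)) {..<c}" for i
    using slopes \<epsilon>(1) by (simp add: inj_on_def tangent_slope_def)
  show "card (crossings (tangent_slope \<epsilon> \<alpha>) (tangent_intercept \<epsilon> \<beta>) ({i} \<times> {..<j}) (i, j)) =
      card (crossings \<alpha> \<beta> {..<j} j)" for i j
    by (rule arg_cong[of _ _ card]) (auto simp: crossings_def meet_iff)
  show "x \<in> I j - {0<..<real n}"
    if "j < c" "j' < c" "j \<noteq> j'" "tangent_slope \<epsilon> \<alpha> (i, j) * x + tangent_intercept \<epsilon> \<beta> (i, j) =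
      tangent_slope \<epsilon> \<alpha> (i, j') * x + tangent_intercept \<epsilon> \<beta> (i, j')" for i j j' x
    using that vertex unfolding meet_iff by blast
qed (use \<epsilon>(2) piece in auto)

lemma is_max_regions_perturbed_tangents:
  fixes \<alpha> \<beta> :: "nat \<Rightarrow> real" and I :: "nat \<Rightarrow> real set"
  assumes F: "\<And>S. S \<in> F \<Longrightarrow> cuts_like_pieces c d S"
    and slopes: "inj_on \<alpha> {..<c}"
    and vertex: "\<And>j j' x. \<lbrakk>j < c; j' < c; j \<noteq> j'; \<alpha> j * x + \<beta> j = \<alpha> j' * x + \<beta> j'\<rbrakk>
      \<Longrightarrow> x \<in> I j - {0<..<real n}"
    and piece: "\<And>j. j < c \<Longrightarrow> closed (I j) \<and> finite (components (- I j)) \<and> {0<..<real n} \<subseteq> I j"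
    and ends: "(\<Sum>j<c. card (components (- I j))) + d \<le> (\<Sum>j<c. card (crossings \<alpha> \<beta> {..<j} j)) + c"
    and shape: "\<And>s t \<epsilon>. 0 < \<epsilon> \<Longrightarrow> (\<Union>j<c. graph_point (s + \<epsilon> * \<alpha> j) (t + \<epsilon> * \<beta> j) ` I j) \<in> F"
  shows "is_max_regions F n (real (region_count c d n))"
proof -
  obtain \<epsilon> where \<epsilon>: "0 < \<epsilon>" "separated_clusters n c (tangent_slope \<epsilon> \<alpha>) (tangent_intercept \<epsilon> \<beta>)"
    by (rule ex_separated_tangents)
  interpret line_clusters n c "tangent_slope \<epsilon> \<alpha>" "tangent_intercept \<epsilon> \<beta>" I
      "\<lambda>j. card (crossings \<alpha> \<beta> {..<j} j)"
    using \<epsilon> slopes vertex piece by (rule line_clusters_tangents)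
  define S where "S i = (\<Union>j<c. graph_point (2 * real i + \<epsilon> * \<alpha> j) (- (real i)\<^sup>2 + \<epsilon> * \<beta> j) ` I j)" for i
  have S_in: "S i \<in> F" for i unfolding S_def using \<epsilon>(1) by (rule shape)
  have upper: "finite (regions n T) \<and> card (regions n T) \<le> region_count c d n"
    if "\<forall>i<n. T i \<in> F" for T
    using that F by (intro card_regions_le) blast
  have "(\<Union>i<n. S i) = (\<Union>i<n. \<Union>j<c.
      graph_point (tangent_slope \<epsilon> \<alpha> (i, j)) (tangent_intercept \<epsilon> \<beta> (i, j)) ` I j)"
    by (simp add: S_def tangent_slope_def tangent_intercept_def)
  then have "region_count c d n \<le> card (regions n S)"
    using card_regions_clusters_ge[OF _ ends] upper[of S] S_in
    by (simp add: regions_def Compl_eq_Diff_UNIV)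
  then have "card (regions n S) = region_count c d n"
    using upper[of S] S_in by simp
  then show ?thesis
    unfolding is_max_regions_def using upper S_in by (metis of_nat_le_iff)
qed

section \<open>The three families\<close>

lemma components_lessThan: "components {..<u} = {{..<u}}" for u :: real
  by (simp add: components_eq_sing_iff)

lemma components_greaterThan: "components {l<..} = {{l<..}}" for l :: real
  by (simp add: components_eq_sing_iff)

lemma finite_card_components_Compl_atLeastAtMost:
  fixes l u :: real
  assumes "l \<le> u"
  shows "finite (components (- {l..u})) \<and> card (components (- {l..u})) = 2"
proof -
  have "components (- {l..u}) = {{..<l}, {u<..}}"
    using assms by (intro components_open_unique) (auto simp: pairwise_def disjnt_def)
  moreover have "u + 1 \<in> {u<..}" "u + 1 \<notin> {..<l}" using assms by auto
  then have "{..<l} \<noteq> {u<..}" by blast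
  ultimately show ?thesis by simp
qed

lemma lessThan_3: "{..<3} = {0, 1, 2 :: nat}"
  by auto

lemma is_max_regions_three_armed_Vs:
  "is_max_regions three_armed_Vs n (real (region_count 3 2 n))"
proof (rule is_max_regions_perturbed_tangents)
  show "(\<Union>j<3. graph_point (s + \<epsilon> * real j) (t + \<epsilon> * 0) ` {0..}) \<in> three_armed_Vs" for s t \<epsilon>
  proof -
    have "(\<Union>j<3. graph_point (s + \<epsilon> * real j) (t + \<epsilon> * 0) ` {0..}) =
        ray (vector [0, t]) (vector [1, s]) \<union> ray (vector [0, t]) (vector [1, s + \<epsilon>])
        \<union> ray (vector [0, t]) (vector [1, s + \<epsilon> * 2])"
      by (simp add: ray_eq_along lessThan_3 Un_assoc)
    then show ?thesis unfolding three_armed_Vs_def using slope_vector_nonzero by blast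
  qed
  have "crossings real (\<lambda>_. 0) {..<j} j = (if j = 0 then {} else {0})" for j :: nat
    by (auto simp: crossings_def)
  then show "(\<Sum>j<3::nat. card (components (- {0::real..}))) + 2
      \<le> (\<Sum>j<3. card (crossings real (\<lambda>_. 0) {..<j} j)) + 3"
    by (simp add: components_lessThan lessThan_3)
qed (auto simp: components_lessThan cuts_like_pieces_three_armed_V)

text \<open>A self-crossing 3-chain and a long-legged A can be drawn on the same three lines, which bound a
  triangle whose vertices have the abscissae \<open>-1\<close>, \<open>0\<close> and \<open>n + 1\<close>.\<close>

definition triangle_slope :: "nat \<Rightarrow> nat \<Rightarrow> real" where
  "triangle_slope n = (!) [0, real n + 1, -1]"

definition triangle_intercept :: "nat \<Rightarrow> nat \<Rightarrow> real" where
  "triangle_intercept n = (!) [0, real n + 1, real n + 1]"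

lemmas triangle_defs = triangle_slope_def triangle_intercept_def

lemma triangle_meet_iff:
  fixes n :: nat
  defines "\<alpha> \<equiv> triangle_slope n" and "\<beta> \<equiv> triangle_intercept n"
  shows "\<alpha> 0 * x + \<beta> 0 = \<alpha> 1 * x + \<beta> 1 \<longleftrightarrow> x = -1"
    and "\<alpha> 0 * x + \<beta> 0 = \<alpha> 2 * x + \<beta> 2 \<longleftrightarrow> x = real n + 1"
    and "\<alpha> 1 * x + \<beta> 1 = \<alpha> 2 * x + \<beta> 2 \<longleftrightarrow> x = 0"
proof -
  have "\<alpha> 1 * x + \<beta> 1 = (real n + 1) * (x + 1)"
    by (simp add: \<alpha>_def \<beta>_def triangle_defs algebra_simps)
  then show "\<alpha> 0 * x + \<beta> 0 = \<alpha> 1 * x + \<beta> 1 \<longleftrightarrow> x = -1"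
    by (auto simp: \<alpha>_def \<beta>_def triangle_defs)
  show "\<alpha> 0 * x + \<beta> 0 = \<alpha> 2 * x + \<beta> 2 \<longleftrightarrow> x = real n + 1"
    by (auto simp: \<alpha>_def \<beta>_def triangle_defs)
  have "\<alpha> 1 * x + \<beta> 1 = \<alpha> 2 * x + \<beta> 2 \<longleftrightarrow> (real n + 2) * x = 0"
    by (auto simp: \<alpha>_def \<beta>_def triangle_defs algebra_simps)
  then show "\<alpha> 1 * x + \<beta> 1 = \<alpha> 2 * x + \<beta> 2 \<longleftrightarrow> x = 0"
    by (simp add: add_nonneg_eq_0_iff)
qed

lemma is_max_regions_on_triangle:
  fixes I\<^sub>0 I\<^sub>1 I\<^sub>2 :: "real set"
  assumes F: "\<And>S. S \<in> F \<Longrightarrow> cuts_like_pieces 3 2 S"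
    and I: "\<And>J. J \<in> {I\<^sub>0, I\<^sub>1, I\<^sub>2} \<Longrightarrow> closed J \<and> finite (components (- J)) \<and> {0<..<real n} \<subseteq> J"
    and vertices: "{-1, real n + 1} \<subseteq> I\<^sub>0" "{-1, 0} \<subseteq> I\<^sub>1" "{0, real n + 1} \<subseteq> I\<^sub>2"
    and ends: "card (components (- I\<^sub>0)) + card (components (- I\<^sub>1)) + card (components (- I\<^sub>2)) = 4"
    and shape: "\<And>s t \<epsilon>. graph_point s t ` I\<^sub>0
      \<union> graph_point (s + \<epsilon> * (real n + 1)) (t + \<epsilon> * (real n + 1)) ` I\<^sub>1
      \<union> graph_point (s - \<epsilon>) (t + \<epsilon> * (real n + 1)) ` I\<^sub>2 \<in> F"
  shows "is_max_regions F n (real (region_count 3 2 n))"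
proof -
  define \<alpha> \<beta> I where "\<alpha> = triangle_slope n" and "\<beta> = triangle_intercept n"
    and "I = (!) [I\<^sub>0, I\<^sub>1, I\<^sub>2]"
  note triple_defs = \<alpha>_def \<beta>_def triangle_defs I_def
  note meet = triangle_meet_iff[of n, folded \<alpha>_def \<beta>_def]
  show ?thesis
  proof (rule is_max_regions_perturbed_tangents[where \<alpha> = \<alpha> and \<beta> = \<beta> and I = I])
    show "inj_on \<alpha> {..<3}" by (simp add: lessThan_3 triple_defs)
    have "crossings \<alpha> \<beta> {..<1} 1 = {-1}" "crossings \<alpha> \<beta> {..<2} 2 = {0, real n + 1}"
      using meet by (auto simp: crossings_def lessThan_nat_numeral eq_commute)
    then show "(\<Sum>j<3. card (components (- I j))) + 2 \<le> (\<Sum>j<3. card (crossings \<alpha> \<beta> {..<j} j)) + 3"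
      using ends by (simp add: lessThan_3 triple_defs)
    show "(\<Union>j<3. graph_point (s + \<epsilon> * \<alpha> j) (t + \<epsilon> * \<beta> j) ` I j) \<in> F" for s t \<epsilon>
      using shape[where s = s and t = t and \<epsilon> = \<epsilon>] by (simp add: lessThan_3 triple_defs Un_assoc)
    show "x \<in> I j - {0<..<real n}"
      if "j < 3" "j' < 3" "j \<noteq> j'" "\<alpha> j * x + \<beta> j = \<alpha> j' * x + \<beta> j'" for j j' x
    proof -
      have "j \<in> {0, 1, 2}" "j' \<in> {0, 1, 2}" using that(1,2) by auto
      then have "x = -1 \<and> j \<noteq> 2 \<or> x = real n + 1 \<and> j \<noteq> 1 \<or> x = 0 \<and> j \<noteq> 0"
        using that(3,4) meet[of x] by auto
      then show ?thesis using vertices \<open>j \<in> {0, 1, 2}\<close> by (auto simp: I_def)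
    qed
    show "closed (I j) \<and> finite (components (- I j)) \<and> {0<..<real n} \<subseteq> I j" if "j < 3" for j
    proof (rule I)
      have "j \<in> {0, 1, 2}" using that by auto
      then show "I j \<in> {I\<^sub>0, I\<^sub>1, I\<^sub>2}" by (auto simp: I_def)
    qed
  qed (rule F)
qed

lemma is_max_regions_three_chains:
  "is_max_regions three_chains n (real (region_count 3 2 n))"
proof (rule is_max_regions_on_triangle[of _ "{-1..real n + 1}" "{-1..}" "{..real n + 1}" n])
  fix s t \<epsilon> :: real
  let ?h = "\<epsilon> * (real n + 1)"
  define p where "p = graph_point s t (-1)"
  define q where "q = graph_point s t (real n + 1)"
  have p: "p = graph_point (s + ?h) (t + ?h) (-1)"
    and q: "q = graph_point (s - \<epsilon>) (t + ?h) (real n + 1)"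
    and "p \<noteq> q"
    unfolding p_def q_def graph_point_eq_iff by (simp_all add: algebra_simps)
  have "graph_point s t ` {-1..real n + 1} = closed_segment p q"
    unfolding p_def q_def by (rule along_image_atLeastAtMost) simp
  then have "graph_point s t ` {-1..real n + 1} \<union> graph_point (s + ?h) (t + ?h) ` {-1..}
      \<union> graph_point (s - \<epsilon>) (t + ?h) ` {..real n + 1} =
    ray p (vector [1, s + ?h]) \<union> closed_segment p q \<union> ray q (- vector [1, s - \<epsilon>])"
    unfolding along_image_atLeast along_image_atMost p[symmetric] q[symmetric] by blast
  also have "\<dots> \<in> three_chains"
    unfolding three_chains_def using \<open>p \<noteq> q\<close> slope_vector_nonzero neg_equal_0_iff_equal by blast
  finally show "graph_point s t ` {-1..real n + 1} \<union> graph_point (s + ?h) (t + ?h) ` {-1..}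
      \<union> graph_point (s - \<epsilon>) (t + ?h) ` {..real n + 1} \<in> three_chains" .
qed (auto simp: components_lessThan components_greaterThan finite_card_components_Compl_atLeastAtMost
  cuts_like_pieces_three_chain)

lemma is_max_regions_long_legged_As:
  "is_max_regions long_legged_As n (real (region_count 3 2 n))"
proof (rule is_max_regions_on_triangle[of _ "{-1..}" "{-1..}" "{0..real n + 1}" n])
  fix s t \<epsilon> :: real
  let ?h = "\<epsilon> * (real n + 1)"
  define p where "p = graph_point s t (-1)"
  define q where "q = graph_point s t (real n + 1)"
  define r where "r = graph_point (s + ?h) (t + ?h) 0"
  have p: "p = graph_point (s + ?h) (t + ?h) (-1)"
    and q: "q = graph_point (s - \<epsilon>) (t + ?h) (real n + 1)"
    and r: "r = graph_point (s - \<epsilon>) (t + ?h) 0" and "q \<noteq> r"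
    unfolding p_def q_def r_def graph_point_eq_iff by (simp_all add: algebra_simps)
  have rays: "graph_point s t ` {-1..} = ray p (vector [1, s])"
    "graph_point (s + ?h) (t + ?h) ` {-1..} = ray p (vector [1, s + ?h])"
    unfolding along_image_atLeast p_def[symmetric] p[symmetric] by (rule refl)+
  have "graph_point (s - \<epsilon>) (t + ?h) ` {0..real n + 1} = closed_segment q r"
    unfolding q r by (subst closed_segment_commute) (rule along_image_atLeastAtMost, simp)
  moreover have "q \<in> ray p (vector [1, s])" "r \<in> ray p (vector [1, s + ?h])"
    unfolding rays[symmetric] q_def r_def by (intro imageI; simp)+
  ultimately show "graph_point s t ` {-1..} \<union> graph_point (s + ?h) (t + ?h) ` {-1..}
      \<union> graph_point (s - \<epsilon>) (t + ?h) ` {0..real n + 1} \<in> long_legged_As"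
    unfolding long_legged_As_def rays using \<open>q \<noteq> r\<close> slope_vector_nonzero by blast
qed (auto simp: components_lessThan finite_card_components_Compl_atLeastAtMost
  cuts_like_pieces_long_legged_A)

lemma region_count_3_2: "real (region_count 3 2 n) = (9 * real n ^ 2 - 5 * real n + 2) / 2"
  unfolding region_count_def
  by (induction n) (simp_all add: power2_eq_square algebra_simps add_divide_distrib)

theorem theorem1:
  fixes n :: nat
  shows "is_max_regions three_armed_Vs n ((9 * real n ^ 2 - 5 * real n + 2) / 2)
       \<and> is_max_regions three_chains n ((9 * real n ^ 2 - 5 * real n + 2) / 2)
       \<and> is_max_regions long_legged_As n ((9 * real n ^ 2 - 5 * real n + 2) / 2)"
  using is_max_regions_three_armed_Vs is_max_regions_three_chains is_max_regions_long_legged_As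
  unfolding region_count_3_2 by blast

end
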